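(* Let $G=(V,E)$ be a tree with $1<|V|<\infty$ and edge weights $q=(q_e)_{e\in E}$. (i) Assume that $q\in(-\infty,1)^E$, $\beta\in(0,\infty)$ and $a\in(0,\infty)^V$. For a random vector $K$ taking values in $\mathcal D$, one has $K\sim \mathrm{TB}^G_{\mathrm I}(a,\beta,q)$ if and only if for any $r\in V$ the random vector $\Psi^{(r)}(K)=(\Psi^{(r)}_v(K))_{v\in V}$ has independent components with distributions $$\Psi^{(r)}_r(K)\sim \mathrm{Beta}_{\mathrm I}(a_r,\beta)\quad\text{and}\quad \Psi^{(r)}_v(K)\sim \mathrm{GB}_{\mathrm I}(a_v,\beta+a_{v_r},a_{v_r};q_{v_r,v})\ \text{ for } v\in V\setminus\{r\}.$$ (ii) Assume that $q\in[0,\infty)^E$, $\beta\in(0,\infty)$ and $a\in(0,\beta)^V$ is such that $a_v+a_w<\beta$ for every $\{v,w\}\in E$ with $q_{v,w}=0$. For a random vector $K$ taking values in $(0,\infty)^V$, one has $K\sim \mathrm{TB}^G_{\mathrm{II}}(a,\beta,q)$ if and only if for any $r\in V$ the random vector $\psi^{(r)}(K)=(\psi^{(r)}_v(K))_{v\in V}$ has independent components with distributions $$\psi^{(r)}_r(K)\sim \mathrm{Beta}_{\mathrm{II}}(a_r,\beta)\quad\text{and}\quad \psi^{(r)}_v(K)\sim \mathrm{GB}_{\mathrm{II}}(a_v,\beta-a_{v_r},a_{v_r};q_{v_r,v})\ \text{ for } v\in V\setminus\{r\}.$$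
   Context: Polynomials. For $e=\{v,w\}\in E$ write $q_{v,w}=q_{w,v}=q_e$. For $U\subseteq V$ let $E_U$ be the set of edges of $G$ with both ends in $U$, $k^U=\prod_{v\in U}k_v$, $q^{E_U}=\prod_{e\in E_U}q_e$ (empty products equal $1$). For $U\subseteq V$ and $k\in\mathbb R^V$, $$\Delta_U(k)=\sum_{W\subseteq U}(-1)^{|W|}q^{E_W}k^W,\qquad \delta_U(k)=\sum_{W\subseteq U}q^{E_W}k^W,$$ and $\Delta_G=\Delta_V$, $\delta_G=\delta_V$. Put $\mathcal D=\{k\in(0,1)^V:\ \Delta_U(k)>0\ \ \forall\, U\subseteq V\}$. Tree-beta laws. For $a\in(0,\infty)^V$, $\beta>0$, $q\in(-\infty,1)^E$, $\mathrm{TB}^G_{\mathrm I}(a,\beta,q)$ is the probability law on $\mathbb R^V$ with Lebesgue density proportional to $\Delta_G(k)^{\beta-1}\prod_{v\in V}k_v^{a_v-1}\mathbf 1_{\mathcal D}(k)$. For $\beta>0$, $a\in(0,\beta)^V$, $q\in[0,\infty)^E$ with $a_v+a_w<\beta$ whenever $\{v,w\}\in E$ and $q_{v,w}=0$, $\mathrm{TB}^G_{\mathrm{II}}(a,\beta,q)$ is the probability law with density proportional to $\delta_G(k)^{-\beta}\prod_{v\in V}k_v^{a_v-1}\mathbf 1_{(0,\infty)^V}(k)$. Rooted trees and maps. For $r\in V$, $G^{(r)}$ is the directed tree obtained from $G$ by orienting each edge away from $r$: $v\to w$ if $\{v,w\}\in E$ and $v$ lies on the path from $r$ to $w$. For $v\in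 V\setminus\{r\}$, $v_r$ denotes the parent of $v$ in $G^{(r)}$, i.e. the unique vertex with $v_r\to v$. $\mathfrak{de}^{(r)}(v)$ is the set of $w\ne v$ such that there is a directed path in $G^{(r)}$ from $v$ to $w$, and $\overline{\mathfrak{de}}^{(r)}(v)=\mathfrak{de}^{(r)}(v)\cup\{v\}$. For $q\in(-\infty,1)^E$, $\Psi^{(r)}:\mathcal D\to(0,1)^V$ is $$\Psi^{(r)}_v(k)=1-\frac{\Delta_{\overline{\mathfrak{de}}^{(r)}(v)}(k)}{\Delta_{\mathfrak{de}^{(r)}(v)}(k)},\quad v\in V,$$ and for $q\in[0,\infty)^E$, $\psi^{(r)}:(0,\infty)^V\to(0,\infty)^V$ is $$\psi^{(r)}_v(k)=\frac{\delta_{\overline{\mathfrak{de}}^{(r)}(v)}(k)}{\delta_{\mathfrak{de}^{(r)}(v)}(k)}-1,\quad v\in V.$$ Univariate laws (densities up to normalization). $\mathrm{Beta}_{\mathrm I}(\alpha,\beta)$, $\alpha,\beta>0$: $x^{\alpha-1}(1-x)^{\beta-1}\mathbf 1_{(0,1)}(x)$. $\mathrm{GB}_{\mathrm I}(\alpha,\beta,\gamma;q)$, $\alpha,\beta>0$, $\gamma\in\mathbb R$, $q<1$: $x^{\alpha-1}(1-x)^{\beta-1}(1-qx)^{-\gamma}\mathbf 1_{(0,1)}(x)$. $\mathrm{Beta}_{\mathrm{II}}(\alpha,\beta)$, $\beta>\alpha>0$: $x^{\alpha-1}(1+x)^{-\beta}\mathbf 1_{(0,\infty)}(x)$. $\mathrm{GB}_{\mathrm{II}}(\alpha,\beta,\gamma;q)$,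 $q>0$, $\beta+\gamma>\alpha>0$: $x^{\alpha-1}(1+x)^{-\beta}(1+qx)^{-\gamma}\mathbf 1_{(0,\infty)}(x)$; and $\mathrm{GB}_{\mathrm{II}}(\alpha,\beta,\gamma;0)=\mathrm{Beta}_{\mathrm{II}}(\alpha,\beta)$ when $\beta>\alpha>0$. *)

theory Defs
  imports "HOL-Probability.Probability"
begin

definition simple_graph :: "'v set \<Rightarrow> 'v set set \<Rightarrow> bool" where
  "simple_graph V E \<longleftrightarrow>
     finite V \<and> (\<forall>e\<in>E. \<exists>v\<in>V. \<exists>w\<in>V. v \<noteq> w \<and> e = {v, w})"

definition is_path :: "'v set \<Rightarrow> 'v set set \<Rightarrow> 'v \<Rightarrow> 'v list \<Rightarrow> 'v \<Rightarrow> bool" where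
  "is_path V E v p w \<longleftrightarrow>
     p \<noteq> [] \<and> hd p = v \<and> last p = w \<and> set p \<subseteq> V \<and> distinct p \<and>
     successively (\<lambda>x y. {x, y} \<in> E) p"

definition is_cycle :: "'v set \<Rightarrow> 'v set set \<Rightarrow> 'v list \<Rightarrow> bool" where
  "is_cycle V E c \<longleftrightarrow>
     length c \<ge> 3 \<and> set c \<subseteq> V \<and> distinct c \<and>
     successively (\<lambda>x y. {x, y} \<in> E) c \<and> {last c, hd c} \<in> E"

definition tree :: "'v set \<Rightarrow> 'v set set \<Rightarrow> bool" where
  "tree V E \<longleftrightarrow>
     simple_graph V E \<and> V \<noteq> {} \<and>
     (\<forall>v\<in>V. \<forall>w\<in>V. \<exists>p. is_path V E v p w) \<and>
     \<not> (\<exists>c. is_cycle V E c)"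

text \<open>In a tree the path from the root \<open>r\<close> to \<open>w\<close> is unique, so the existential
  quantifier below refers to that path.\<close>

definition arcs_from :: "'v set \<Rightarrow> 'v set set \<Rightarrow> 'v \<Rightarrow> ('v \<times> 'v) set" where
  "arcs_from V E r = {(v, w). {v, w} \<in> E \<and> (\<exists>p. is_path V E r p w \<and> v \<in> set p)}"

definition parent :: "'v set \<Rightarrow> 'v set set \<Rightarrow> 'v \<Rightarrow> 'v \<Rightarrow> 'v" where
  "parent V E r v = (THE u. (u, v) \<in> arcs_from V E r)"

definition descendants :: "'v set \<Rightarrow> 'v set set \<Rightarrow> 'v \<Rightarrow> 'v \<Rightarrow> 'v set" where
  "descendants V E r v = {w. w \<noteq> v \<and> (v, w) \<in> (arcs_from V E r)\<^sup>*}"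

definition closed_descendants :: "'v set \<Rightarrow> 'v set set \<Rightarrow> 'v \<Rightarrow> 'v \<Rightarrow> 'v set" where
  "closed_descendants V E r v = insert v (descendants V E r v)"

definition edges_in :: "'v set set \<Rightarrow> 'v set \<Rightarrow> 'v set set" where
  "edges_in E U = {e \<in> E. e \<subseteq> U}"

definition Delta :: "'v set set \<Rightarrow> ('v set \<Rightarrow> real) \<Rightarrow> 'v set \<Rightarrow> ('v \<Rightarrow> real) \<Rightarrow> real" where
  "Delta E q U k =
     (\<Sum>W\<in>Pow U. (-1) ^ card W * (\<Prod>e\<in>edges_in E W. q e) * (\<Prod>v\<in>W. k v))"

definition delta :: "'v set set \<Rightarrow> ('v set \<Rightarrow> real) \<Rightarrow> 'v set \<Rightarrow> ('v \<Rightarrow> real) \<Rightarrow> real" where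
  "delta E q U k = (\<Sum>W\<in>Pow U. (\<Prod>e\<in>edges_in E W. q e) * (\<Prod>v\<in>W. k v))"

text \<open>Vectors indexed by \<open>V\<close> are functions that are \<open>undefined\<close> outside \<open>V\<close>, i.e. the
  points of the product spaces \<open>Pi\<^sub>M V\<close>.\<close>

definition TB_domain :: "'v set \<Rightarrow> 'v set set \<Rightarrow> ('v set \<Rightarrow> real) \<Rightarrow> ('v \<Rightarrow> real) set" where
  "TB_domain V E q = {k \<in> V \<rightarrow>\<^sub>E {0<..<1}. \<forall>U. U \<subseteq> V \<longrightarrow> Delta E q U k > 0}"

definition Psi ::
  "'v set \<Rightarrow> 'v set set \<Rightarrow> ('v set \<Rightarrow> real) \<Rightarrow> 'v \<Rightarrow> 'v \<Rightarrow> ('v \<Rightarrow> real) \<Rightarrow> real" where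
  "Psi V E q r v k =
     1 - Delta E q (closed_descendants V E r v) k / Delta E q (descendants V E r v) k"

definition psi ::
  "'v set \<Rightarrow> 'v set set \<Rightarrow> ('v set \<Rightarrow> real) \<Rightarrow> 'v \<Rightarrow> 'v \<Rightarrow> ('v \<Rightarrow> real) \<Rightarrow> real" where
  "psi V E q r v k =
     delta E q (closed_descendants V E r v) k / delta E q (descendants V E r v) k - 1"

text \<open>The law with density proportional to \<open>f \<ge> 0\<close> with respect to \<open>N\<close>. If the integral
  of \<open>f\<close> is \<open>0\<close> or \<open>\<infinity>\<close>, this is the null measure, hence not the law of
  any random variable.\<close>

definition law_prop :: "'a measure \<Rightarrow> ('a \<Rightarrow> real) \<Rightarrow> 'a measure" where
  "law_prop N f = density N (\<lambda>x. ennreal (f x) / (\<integral>\<^sup>+ y. ennreal (f y) \<partial>N))"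

definition TB_I ::
  "'v set \<Rightarrow> 'v set set \<Rightarrow> ('v \<Rightarrow> real) \<Rightarrow> real \<Rightarrow> ('v set \<Rightarrow> real) \<Rightarrow> ('v \<Rightarrow> real) measure" where
  "TB_I V E a \<beta> q = law_prop (\<Pi>\<^sub>M v\<in>V. lborel)
     (\<lambda>k. Delta E q V k powr (\<beta> - 1) * (\<Prod>v\<in>V. k v powr (a v - 1))
          * indicator (TB_domain V E q) k)"

definition TB_II ::
  "'v set \<Rightarrow> 'v set set \<Rightarrow> ('v \<Rightarrow> real) \<Rightarrow> real \<Rightarrow> ('v set \<Rightarrow> real) \<Rightarrow> ('v \<Rightarrow> real) measure" where
  "TB_II V E a \<beta> q = law_prop (\<Pi>\<^sub>M v\<in>V. lborel)
     (\<lambda>k. delta E q V k powr (- \<beta>) * (\<Prod>v\<in>V. k v powr (a v - 1))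
          * indicator (V \<rightarrow>\<^sub>E {0<..}) k)"

definition Beta_I :: "real \<Rightarrow> real \<Rightarrow> real measure" where
  "Beta_I \<alpha> \<beta> = law_prop lborel
     (\<lambda>x. x powr (\<alpha> - 1) * (1 - x) powr (\<beta> - 1) * indicator {0<..<1} x)"

definition GB_I :: "real \<Rightarrow> real \<Rightarrow> real \<Rightarrow> real \<Rightarrow> real measure" where
  "GB_I \<alpha> \<beta> \<gamma> q = law_prop lborel
     (\<lambda>x. x powr (\<alpha> - 1) * (1 - x) powr (\<beta> - 1) * (1 - q * x) powr (- \<gamma>)
          * indicator {0<..<1} x)"

definition Beta_II :: "real \<Rightarrow> real \<Rightarrow> real measure" where
  "Beta_II \<alpha> \<beta> = law_prop lborel
     (\<lambda>x. x powr (\<alpha> - 1) * (1 + x) powr (- \<beta>) * indicator {0<..} x)"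

definition GB_II :: "real \<Rightarrow> real \<Rightarrow> real \<Rightarrow> real \<Rightarrow> real measure" where
  "GB_II \<alpha> \<beta> \<gamma> q = (if q = 0 then Beta_II \<alpha> \<beta> else law_prop lborel
     (\<lambda>x. x powr (\<alpha> - 1) * (1 + x) powr (- \<beta>) * (1 + q * x) powr (- \<gamma>)
          * indicator {0<..} x))"

end

theory Submission
  imports Defs
begin

text \<open>
  Fix a root \<open>r\<close> and treat both parts at once with a sign \<open>s\<close>, using
  \<open>\<Delta>\<^sub>U(k) = \<delta>\<^sub>U(-k)\<close>. Expanding \<open>\<delta>\<close> at a vertex \<open>v\<close> shows that the
  coordinates \<open>x\<^sub>v\<close> of \<open>\<Psi>\<close> (or \<open>\<psi>\<close>) satisfy
  \<open>k\<^sub>v = x\<^sub>v \<Prod>\<^sub>w (1 + s x\<^sub>w) / (1 + s q\<^sub>v\<^sub>w x\<^sub>w)\<close>, the product being over the children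
  \<open>w\<close> of \<open>v\<close>, and that \<open>\<delta>\<^sub>V = \<Prod>\<^sub>v (1 + s x\<^sub>v)\<close>. The inverse map is therefore explicit and
  triangular, its Jacobian is a product over the edges, and the joint density turns into a
  product of one-dimensional densities. The normalising constant of the joint density is the
  product of those of the factors, so if one of these is degenerate, both sides of the
  equivalence fail and no convergence of integrals has to be checked.
\<close>

section \<open>Rooted trees\<close>

text \<open>No differentiability enters. \<open>T\<close> multiplies each coordinate by a positive
  measurable function of coordinates farther from the root, so Tonelli and one-dimensional scalings
  give its change of variables on the whole product space. The exponents of the univariate laws come
  from one cancellation: the Jacobian factor at v, times the (a_v - 1)-th power of the same factor
  in the density, is its a_v-th power; collecting these powers at the children leaves each non-root
  w with (1 + s x_w) / (1 + s q x_w) raised to the parameter a of its parent. The obstacle is the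
  image of the inverse map for the first kind. Membership in \<open>\<D>\<close> demands positivity
  for every subset of V, while the coordinates see only full subtrees, and alternating signs rule
  out a termwise estimate. A monotonicity argument along the tree settles it.\<close>

lemma tree_edgeD:
  assumes "tree V E" "{v, w} \<in> E"
  shows "v \<in> V" "w \<in> V" "v \<noteq> w"
proof -
  obtain x y where "x \<in> V" "y \<in> V" "x \<noteq> y" "{v, w} = {x, y}"
    using assms unfolding tree_def simple_graph_def by blast
  then show "v \<in> V" "w \<in> V" "v \<noteq> w"
    by (auto simp: doubleton_eq_iff)
qed

lemma tree_no_cycle: "tree V E \<Longrightarrow> \<not> is_cycle V E c"
  by (auto simp: tree_def)

lemma successively_edge_rev:
  "successively (\<lambda>x y. {x, y} \<in> E) (rev p) \<longleftrightarrow> successively (\<lambda>x y. {x, y} \<in> E) p"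
  by (simp add: insert_commute)

text \<open>Vertices strictly between \<open>u\<close> and \<open>w\<close> on the path would form a
  cycle together with the edge \<open>{u, w}\<close>; hence \<open>u\<close> immediately precedes
  \<open>w\<close>.\<close>

lemma arc_penultimate:
  assumes tr: "tree V E" and arc: "(u, w) \<in> arcs_from V E r"
  shows "\<exists>p. is_path V E r (p @ [u, w]) w"
proof -
  from arc obtain p where e: "{u, w} \<in> E" and p: "is_path V E r p w" and u: "u \<in> set p"
    by (auto simp: arcs_from_def)
  from u obtain xs ys where xy: "p = xs @ u # ys" by (auto dest: split_list)
  have "u \<noteq> w" using tree_edgeD[OF tr e] by simp
  with p xy have "ys \<noteq> []" by (auto simp: is_path_def)
  then obtain zs where ys: "ys = zs @ [w]"
    using p xy by (cases ys rule: rev_cases) (auto simp: is_path_def)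
  show ?thesis
  proof (cases "zs = []")
    case True
    then show ?thesis using p xy ys by auto
  next
    case False
    have "is_cycle V E (u # zs @ [w])"
      using p e False unfolding is_path_def is_cycle_def xy ys
      by (auto simp: successively_append_iff insert_commute Suc_le_eq)
    then show ?thesis using tree_no_cycle[OF tr] by blast
  qed
qed

text \<open>Two different predecessors of a vertex would close a cycle through the last common
  vertex of the two paths leading to them.\<close>

lemma arcs_from_unique:
  assumes tr: "tree V E" and "(u, w) \<in> arcs_from V E r" "(u', w) \<in> arcs_from V E r"
  shows "u = u'"
proof (rule ccontr)
  assume neq: "u \<noteq> u'"
  from arc_penultimate[OF tr assms(2)] obtain p where p: "is_path V E r (p @ [u, w]) w" by blast
  from arc_penultimate[OF tr assms(3)] obtain p' where p': "is_path V E r (p' @ [u', w]) w" by blast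
  define P P' where "P = p @ [u]" and "P' = p' @ [u']"
  have pw: "is_path V E r (P @ [w]) w" and pw': "is_path V E r (P' @ [w]) w"
    using p p' by (auto simp: P_def P'_def)
  have "P \<noteq> []" "P' \<noteq> []" by (simp_all add: P_def P'_def)
  then have "r \<in> set P" "r \<in> set P'"
    using pw pw' hd_in_set[of P] hd_in_set[of P'] by (simp_all add: is_path_def)
  then have "\<exists>z\<in>set (rev P). z \<in> set P'" by auto
  from split_list_first_propE[OF this] obtain xs z ys where
    xy: "rev P = xs @ z # ys" and z: "z \<in> set P'" and xs: "\<forall>x\<in>set xs. x \<notin> set P'"
    by metis
  from z obtain as bs where ab: "P' = as @ z # bs" by (auto dest: split_list)
  have hd: "hd (xs @ [z]) = u" using arg_cong[OF xy, of hd] by (simp add: P_def hd_append)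
  have last: "last (z # bs) = u'" using arg_cong[OF ab, of last] by (simp add: P'_def)
  define c where "c = xs @ (z # bs) @ [w]"
  have "successively (\<lambda>x y. {x, y} \<in> E) (rev P)"
    using pw unfolding successively_edge_rev by (auto simp: is_path_def successively_append_iff)
  then have s1: "successively (\<lambda>x y. {x, y} \<in> E) (xs @ [z])"
    unfolding xy by (auto simp: successively_append_iff)
  have s2: "successively (\<lambda>x y. {x, y} \<in> E) ((z # bs) @ [w])"
    using pw' by (auto simp: is_path_def successively_append_iff ab)
  have "successively (\<lambda>x y. {x, y} \<in> E) c"
    using s1 s2 unfolding c_def by (auto simp: successively_append_iff)
  moreover have "distinct c"
  proof -
    have "distinct (rev P)" "w \<notin> set P" using pw by (auto simp: is_path_def)
    moreover have "set xs \<subseteq> set P" by (metis Un_upper1 set_append set_rev xy)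
    ultimately show ?thesis
      using pw' xs unfolding c_def xy ab is_path_def by auto
  qed
  moreover have "set c \<subseteq> V"
  proof -
    have "set (rev P) \<subseteq> V" using pw by (auto simp: is_path_def)
    then show ?thesis
      using pw' unfolding c_def xy ab is_path_def by auto
  qed
  \<comment> \<open>With \<open>xs\<close> and \<open>bs\<close> both empty, \<open>z\<close> would
    equal both \<open>u\<close> and \<open>u'\<close>.\<close>
  moreover have "length c \<ge> 3"
    using hd last neq unfolding c_def by (cases xs; cases bs) auto
  moreover have "{last c, hd c} \<in> E"
  proof -
    have "hd c = u" using hd unfolding c_def by (cases xs) auto
    moreover have "{u, w} \<in> E" using assms(2) by (simp add: arcs_from_def)
    ultimately show ?thesis by (simp add: c_def insert_commute)
  qed
  ultimately have "is_cycle V E c" by (simp add: is_cycle_def)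
  then show False using tree_no_cycle[OF tr] by blast
qed

section \<open>The orientation away from the root\<close>

locale rooted_tree =
  fixes V :: "'v set" and E :: "'v set set" and r :: 'v
  assumes tree: "tree V E" and root: "r \<in> V"
begin

abbreviation "A \<equiv> arcs_from V E r"
abbreviation "de \<equiv> descendants V E r"
abbreviation "cl \<equiv> closed_descendants V E r"

definition ch :: "'v \<Rightarrow> 'v set" where "ch v = {w. (v, w) \<in> A}"

lemma finite_V [simp]: "finite V"
  using tree by (simp add: tree_def simple_graph_def)

lemma arc_edge: "(v, w) \<in> A \<Longrightarrow> {v, w} \<in> E"
  by (simp add: arcs_from_def)

lemma arc_in_V: "(v, w) \<in> A \<Longrightarrow> v \<in> V" "(v, w) \<in> A \<Longrightarrow> w \<in> V"
  using arc_edge tree_edgeD[OF tree] by blast+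

lemma no_arc_to_root: "(u, r) \<notin> A"
proof
  assume u: "(u, r) \<in> A"
  then obtain p where "is_path V E r (p @ [u, r]) r" using arc_penultimate[OF tree] by blast
  then show False by (cases p) (auto simp: is_path_def)
qed

lemma arc_unique: "(u, w) \<in> A \<Longrightarrow> (u', w) \<in> A \<Longrightarrow> u = u'"
  using arcs_from_unique[OF tree] by blast

text \<open>A path from the root to \<open>v\<close> either already visits \<open>w\<close> or can
  be extended by it.\<close>

lemma edge_imp_arc: assumes e: "{v, w} \<in> E" shows "(v, w) \<in> A \<or> (w, v) \<in> A"
proof -
  have vw: "v \<in> V" "w \<in> V" "v \<noteq> w" using tree_edgeD[OF tree e] by auto
  obtain p where p: "is_path V E r p v" using tree root vw unfolding tree_def by blast
  show ?thesis
  proof (cases "w \<in> set p")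
    case True
    then show ?thesis using p e by (auto simp: arcs_from_def insert_commute)
  next
    case False
    have "is_path V E r (p @ [w]) w" "v \<in> set (p @ [w])"
      using p False e vw by (auto simp: is_path_def successively_append_iff)
    then show ?thesis using e unfolding arcs_from_def by blast
  qed
qed

lemma path_imp_reach: "is_path V E r p w \<Longrightarrow> (r, w) \<in> A\<^sup>*"
proof (induction p arbitrary: w rule: rev_induct)
  case Nil
  then show ?case by (simp add: is_path_def)
next
  case (snoc x p)
  have [simp]: "x = w" using snoc.prems by (simp add: is_path_def)
  show ?case
  proof (cases "p = []")
    case True
    then show ?thesis using snoc.prems by (simp add: is_path_def)
  next
    case False
    have path: "is_path V E r p (last p)"
      using False snoc.prems by (auto simp: is_path_def successively_append_iff hd_append)
    have "{last p, w} \<in> E" "last p \<in> set (p @ [w])"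
      using False snoc.prems by (auto simp: is_path_def successively_append_iff)
    then have "(last p, w) \<in> A" using snoc.prems by (auto simp: arcs_from_def)
    with snoc.IH[OF path] show ?thesis by simp
  qed
qed

lemma reach: "w \<in> V \<Longrightarrow> (r, w) \<in> A\<^sup>*"
  using path_imp_reach tree root unfolding tree_def by blast

text \<open>A directed cycle through \<open>z\<close> passes through the unique predecessor of
  \<open>z\<close>, so it can be moved back along the walk to the root, where no arc ends.\<close>

lemma acyclic_from_root: "(r, v) \<in> A\<^sup>* \<Longrightarrow> (v, v) \<notin> A\<^sup>+"
proof (induction rule: rtrancl_induct)
  case base
  then show ?case using no_arc_to_root by (metis tranclD2)
next
  case (step y z)
  show ?case
  proof
    assume "(z, z) \<in> A\<^sup>+"
    then obtain p where "(z, p) \<in> A\<^sup>*" "(p, z) \<in> A" by (metis tranclD2)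
    then have "(y, y) \<in> A\<^sup>+" using step arc_unique by (metis rtrancl_into_trancl2)
    with step show False by simp
  qed
qed

lemma acyclic_A: "acyclic A"
  unfolding acyclic_def
proof
  fix x
  show "(x, x) \<notin> A\<^sup>+"
    using acyclic_from_root reach arc_in_V(1) by (metis tranclD)
qed

lemma finite_A: "finite A"
  by (rule finite_subset[of _ "V \<times> V"]) (auto dest: arc_in_V)

lemma wf_A: "wf (A\<inverse>)"
  using finite_A acyclic_A by (rule finite_acyclic_wf_converse)

text \<open>Induction from the leaves up to the root.\<close>

lemma child_induct [consumes 1, case_names step]:
  assumes "v \<in> V" "\<And>v. v \<in> V \<Longrightarrow> (\<And>w. w \<in> ch v \<Longrightarrow> P w) \<Longrightarrow> P v"
  shows "P v"
  using wf_A assms(1)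
proof (induction v rule: wf_induct_rule)
  case (less v)
  show ?case by (rule assms(2)) (use less arc_in_V in \<open>auto simp: ch_def\<close>)
qed

lemma ch_subset: "ch v \<subseteq> V"
  by (auto simp: ch_def dest: arc_in_V)

lemma finite_ch [simp]: "finite (ch v)"
  using ch_subset finite_V by (rule finite_subset)

section \<open>Subtrees below the children of a vertex\<close>

lemma cl_eq: "cl v = {w. (v, w) \<in> A\<^sup>*}"
  by (auto simp: closed_descendants_def descendants_def)

lemma de_eq: "de v = (\<Union>w\<in>ch v. cl w)"
proof -
  have "x \<noteq> v \<and> (v, x) \<in> A\<^sup>* \<longleftrightarrow> (v, x) \<in> A\<^sup>+" for x
    using acyclic_A by (metis acyclic_def rtranclD trancl_into_rtrancl)
  then show ?thesis
    by (auto simp: descendants_def cl_eq ch_def trancl_unfold_left)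
qed

lemma cl_subset: "v \<in> V \<Longrightarrow> cl v \<subseteq> V"
  unfolding cl_eq using arc_in_V by (auto elim: rtranclE)

lemma de_subset: "v \<in> V \<Longrightarrow> de v \<subseteq> V"
  using cl_subset by (auto simp: closed_descendants_def)

lemma cl_root: "cl r = V"
  using cl_subset[OF root] reach by (auto simp: cl_eq)

lemma notin_de: "v \<notin> de v"
  by (simp add: descendants_def)

lemma child_cycle: "w \<in> ch v \<Longrightarrow> (w, v) \<notin> A\<^sup>*"
  using acyclic_A unfolding acyclic_def ch_def by (metis mem_Collect_eq rtrancl_into_trancl2)

lemma siblings_unreachable:
  assumes "w \<in> ch v" "w' \<in> ch v" "w \<noteq> w'" shows "(w, w') \<notin> A\<^sup>*"
proof
  assume "(w, w') \<in> A\<^sup>*"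
  then obtain u where "(w, u) \<in> A\<^sup>*" "(u, w') \<in> A" using assms(3) by (metis rtranclE)
  then have "(w, v) \<in> A\<^sup>*" using assms arc_unique by (auto simp: ch_def)
  with child_cycle[OF assms(1)] show False by simp
qed

text \<open>Predecessors are unique, so two ancestors of a common vertex are comparable; distinct
  siblings are not.\<close>

lemma cl_disjoint:
  assumes "w \<in> ch v" "w' \<in> ch v" "w \<noteq> w'" shows "cl w \<inter> cl w' = {}"
proof -
  have sv: "single_valued (A\<inverse>)" by (auto simp: single_valued_def dest: arc_unique)
  have "(w, w') \<in> A\<^sup>* \<or> (w', w) \<in> A\<^sup>*" if "(w, x) \<in> A\<^sup>*" "(w', x) \<in> A\<^sup>*" for x
    using single_valued_confluent[OF sv, of x w w'] that by (auto simp: rtrancl_converse)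
  then show ?thesis using siblings_unreachable assms by (auto simp: cl_eq)
qed

lemma no_edge_between_siblings:
  assumes "w \<in> ch v" "w' \<in> ch v" "w \<noteq> w'" "x \<in> cl w" "y \<in> cl w'" shows "{x, y} \<notin> E"
proof
  assume "{x, y} \<in> E"
  then consider "(x, y) \<in> A" | "(y, x) \<in> A" using edge_imp_arc by blast
  then show False
  proof cases
    case 1
    then have "y \<in> cl w" using assms(4) by (auto simp: cl_eq)
    then show False using cl_disjoint[OF assms(1-3)] assms(5) by blast
  next
    case 2
    then have "x \<in> cl w'" using assms(5) by (auto simp: cl_eq)
    then show False using cl_disjoint[OF assms(1-3)] assms(4) by blast
  qed
qed

text \<open>An arc from \<open>x\<close> back to \<open>v\<close> would close a directed cycle. Thus
  expanding the polynomial at \<open>v\<close> reweights only the children among all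
  descendants.\<close>

lemma edge_to_de: "x \<in> de v \<Longrightarrow> {v, x} \<in> E \<longleftrightarrow> x \<in> ch v"
proof
  assume x: "x \<in> de v" and "{v, x} \<in> E"
  then consider "(v, x) \<in> A" | "(x, v) \<in> A" using edge_imp_arc by blast
  then show "x \<in> ch v"
  proof cases
    case 2
    obtain w where "w \<in> ch v" "(w, x) \<in> A\<^sup>*" using x by (auto simp: de_eq cl_eq)
    then show ?thesis using 2 child_cycle by (meson rtrancl.rtrancl_into_rtrancl)
  qed (simp add: ch_def)
qed (auto simp: ch_def dest: arc_edge)

definition par :: "'v \<Rightarrow> 'v" where "par v = parent V E r v"

lemma par_eq: "(u, v) \<in> A \<Longrightarrow> par v = u"
  unfolding par_def parent_def using arc_unique by blast

lemma par_arc: assumes "v \<in> V" "v \<noteq> r" shows "(par v, v) \<in> A"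
proof -
  obtain u where "(u, v) \<in> A" using reach[OF assms(1)] assms(2) by (metis rtranclE)
  then show ?thesis using par_eq by simp
qed

lemma ch_eq: "v \<in> V \<Longrightarrow> ch v = {w \<in> V - {r}. par w = v}"
  using par_arc par_eq arc_in_V no_arc_to_root by (auto simp: ch_def)

text \<open>Each non-root vertex is the child of exactly one vertex. This regrouping serves both the
  Jacobian and the telescoping of the polynomials.\<close>

lemma prod_ch:
  fixes f :: "'v \<Rightarrow> 'v \<Rightarrow> 'b::comm_monoid_mult"
  shows "(\<Prod>v\<in>V. \<Prod>w\<in>ch v. f v w) = (\<Prod>w\<in>V - {r}. f (par w) w)"
proof -
  have "(\<Prod>v\<in>V. \<Prod>w\<in>ch v. f v w) = (\<Prod>v\<in>V. \<Prod>w\<in>{w. w \<in> V - {r} \<and> par w = v}. f (par w) w)"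
    by (intro prod.cong) (auto simp: ch_eq)
  also have "\<dots> = (\<Prod>w\<in>V - {r}. f (par w) w)"
    using par_arc arc_in_V by (intro prod.group) auto
  finally show ?thesis .
qed

text \<open>The depth of \<open>v\<close>, counted as its number of proper ancestors; it orders the
  integrations in the change of variables.\<close>

definition rk :: "'v \<Rightarrow> nat" where "rk v = card {u. (u, v) \<in> A\<^sup>+}"

lemma rk_less: assumes "w \<in> ch v" shows "rk v < rk w"
  unfolding rk_def
proof (rule psubset_card_mono)
  have "{u. (u, w) \<in> A\<^sup>+} \<subseteq> V" using arc_in_V(1) by (auto dest: tranclD)
  then show "finite {u. (u, w) \<in> A\<^sup>+}" by (rule finite_subset) simp
  have vw: "(v, w) \<in> A" using assms by (simp add: ch_def)
  moreover have "(v, v) \<notin> A\<^sup>+" using acyclic_A by (simp add: acyclic_def)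
  ultimately show "{u. (u, v) \<in> A\<^sup>+} \<subset> {u. (u, w) \<in> A\<^sup>+}"
    by (auto simp: psubset_eq intro: trancl_into_trancl)
qed

end

section \<open>The polynomials on a rooted tree\<close>

lemma tree_edge_card: "tree V E \<Longrightarrow> e \<in> E \<Longrightarrow> card e = 2"
  unfolding tree_def simple_graph_def by (auto simp: card_2_iff)

lemma finite_edges_in: "finite W \<Longrightarrow> finite (edges_in E W)"
  by (rule finite_subset[of _ "Pow W"]) (auto simp: edges_in_def)

lemma Delta_eq_delta: "Delta E q U k = delta E q U (\<lambda>v. - k v)"
  by (simp add: Delta_def delta_def prod_uminus mult_ac)

lemma delta_cong:
  assumes "\<And>v. v \<in> U \<Longrightarrow> k v = k' v" shows "delta E q U k = delta E q U k'"
  unfolding delta_def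
proof (rule sum.cong[OF refl])
  fix W assume "W \<in> Pow U"
  then have "(\<Prod>v\<in>W. k v) = (\<Prod>v\<in>W. k' v)" using assms by (intro prod.cong) auto
  then show "prod q (edges_in E W) * prod k W = prod q (edges_in E W) * prod k' W" by simp
qed

text \<open>A set \<open>W\<close> not contained in \<open>U\<close> picks up a zero factor.
  Positivity for arbitrary subsets is thereby reduced to the full vertex set.\<close>

lemma delta_restrict:
  assumes "finite V" "U \<subseteq> V"
  shows "delta E q U k = delta E q V (\<lambda>v. if v \<in> U then k v else 0)"
proof -
  have "delta E q V (\<lambda>v. if v \<in> U then k v else 0) =
      (\<Sum>W\<in>Pow U. prod q (edges_in E W) * (\<Prod>v\<in>W. if v \<in> U then k v else 0))"
    unfolding delta_def
  proof (rule sum.mono_neutral_right)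
    show "\<forall>W\<in>Pow V - Pow U. prod q (edges_in E W) * (\<Prod>v\<in>W. if v \<in> U then k v else 0) = 0"
    proof
      fix W assume W: "W \<in> Pow V - Pow U"
      then have "finite W" using assms finite_subset by auto
      then have "(\<Prod>v\<in>W. if v \<in> U then k v else 0) = 0"
        using W by (subst prod_zero_iff) auto
      then show "prod q (edges_in E W) * (\<Prod>v\<in>W. if v \<in> U then k v else 0) = 0" by simp
    qed
  qed (use assms in auto)
  also have "\<dots> = delta E q U k"
    unfolding delta_def[symmetric] by (rule delta_cong) simp
  finally show ?thesis by simp
qed

lemma delta_empty:
  assumes "\<And>e. e \<in> E \<Longrightarrow> card e = 2" shows "delta E q {} k = 1"
proof -
  have "edges_in E {} = {}" using assms[of "{}"] by (auto simp: edges_in_def)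
  then show ?thesis by (simp add: delta_def)
qed

lemma sum_Pow_insert:
  fixes f :: "'a set \<Rightarrow> real"
  assumes "finite A" "v \<notin> A"
  shows "(\<Sum>W\<in>Pow (insert v A). f W) = (\<Sum>W\<in>Pow A. f W) + (\<Sum>W\<in>Pow A. f (insert v W))"
proof -
  have inj: "inj_on (insert v) (Pow A)" using assms by (auto simp: inj_on_def)
  show ?thesis
    unfolding Pow_insert
    by (subst sum.union_disjoint) (use assms inj in \<open>auto simp: sum.reindex\<close>)
qed

text \<open>The default 1 at non-neighbours of \<open>v\<close> lets the new edge weights be
  absorbed into \<open>k\<close> vertex by vertex in \<open>delta_insert\<close>.\<close>

lemma prod_edges_insert:
  fixes q :: "'v set \<Rightarrow> real"
  assumes E: "\<And>e. e \<in> E \<Longrightarrow> card e = 2" and W: "finite W" "v \<notin> W"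
  shows "prod q (edges_in E (insert v W)) =
    prod q (edges_in E W) * (\<Prod>w\<in>W. if {v, w} \<in> E then q {v, w} else 1)"
proof -
  let ?N = "{w \<in> W. {v, w} \<in> E}"
  have eq: "edges_in E (insert v W) = edges_in E W \<union> (\<lambda>w. {v, w}) ` ?N"
  proof (intro set_eqI iffI)
    fix e assume e: "e \<in> edges_in E (insert v W)"
    show "e \<in> edges_in E W \<union> (\<lambda>w. {v, w}) ` ?N"
    proof (cases "v \<in> e")
      case True
      have "card e = 2" using e E by (auto simp: edges_in_def)
      then obtain x y where "e = {x, y}" "x \<noteq> y" by (auto simp: card_2_iff)
      then obtain w where "e = {v, w}" "w \<noteq> v" using True by (auto simp: insert_commute)
      then show ?thesis using e by (auto simp: edges_in_def)
    qed (use e in \<open>auto simp: edges_in_def\<close>)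
  qed (auto simp: edges_in_def)
  have inj: "inj_on (\<lambda>w. {v, w}) ?N" by (auto simp: inj_on_def doubleton_eq_iff)
  have "prod q (edges_in E (insert v W)) = prod q (edges_in E W) * prod q ((\<lambda>w. {v, w}) ` ?N)"
    unfolding eq by (rule prod.union_disjoint)
      (use W finite_edges_in in \<open>auto simp: edges_in_def\<close>)
  also have "prod q ((\<lambda>w. {v, w}) ` ?N) = (\<Prod>w\<in>?N. q {v, w})"
    using inj by (simp add: prod.reindex)
  also have "\<dots> = (\<Prod>w\<in>W. if {v, w} \<in> E then q {v, w} else 1)"
    using W by (simp add: prod.inter_filter)
  finally show ?thesis .
qed

lemma delta_insert:
  assumes E: "\<And>e. e \<in> E \<Longrightarrow> card e = 2" and A: "finite A" "v \<notin> A"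
  shows "delta E q (insert v A) k =
    delta E q A k + k v * delta E q A (\<lambda>w. (if {v, w} \<in> E then q {v, w} else 1) * k w)"
proof -
  have "prod q (edges_in E (insert v W)) * prod k (insert v W) =
     k v * (prod q (edges_in E W) * (\<Prod>w\<in>W. (if {v, w} \<in> E then q {v, w} else 1) * k w))"
    if "W \<in> Pow A" for W
  proof -
    have W: "finite W" "v \<notin> W" using that A by (auto intro: finite_subset)
    show ?thesis
      using W by (simp add: prod_edges_insert[OF E W(1) W(2)] prod.distrib mult_ac)
  qed
  then show ?thesis
    unfolding delta_def sum_Pow_insert[OF A] sum_distrib_left by simp
qed

text \<open>Without crossing edges the term of \<open>W \<union> W'\<close> factors, so the sum over
  pairs of subsets is a product of sums.\<close>

lemma delta_union:
  assumes E: "\<And>e. e \<in> E \<Longrightarrow> card e = 2" and fin: "finite A" "finite B" and dis: "A \<inter> B = {}"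
    and cross: "\<And>x y. x \<in> A \<Longrightarrow> y \<in> B \<Longrightarrow> {x, y} \<notin> E"
  shows "delta E q (A \<union> B) k = delta E q A k * delta E q B k"
proof -
  have split: "prod q (edges_in E (W \<union> W')) * prod k (W \<union> W') =
      (prod q (edges_in E W) * prod k W) * (prod q (edges_in E W') * prod k W')"
    if "W \<subseteq> A" "W' \<subseteq> B" for W W'
  proof -
    have f: "finite W" "finite W'" using that fin by (auto intro: finite_subset)
    have "edges_in E (W \<union> W') = edges_in E W \<union> edges_in E W'"
    proof (intro set_eqI iffI)
      fix e assume e: "e \<in> edges_in E (W \<union> W')"
      then have eE: "e \<in> E" by (simp add: edges_in_def)
      then obtain x y where xy: "e = {x, y}" using E[of e] by (auto simp: card_2_iff)
      have "{x, y} \<notin> E \<or> \<not> (x \<in> W \<and> y \<in> W')" "{x, y} \<notin> E \<or> \<not> (y \<in> W \<and> x \<in> W')"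
        using cross[of x y] cross[of y x] that by (auto simp: insert_commute)
      then show "e \<in> edges_in E W \<union> edges_in E W'"
        using e eE unfolding xy by (auto simp: edges_in_def)
    qed (auto simp: edges_in_def)
    \<comment> \<open>Only the empty set could lie in both families, and it is not an edge because
      edges have two elements.\<close>
    moreover have "edges_in E W \<inter> edges_in E W' = {}"
    proof -
      have False if "e \<in> edges_in E W" "e \<in> edges_in E W'" for e
      proof -
        have "e \<subseteq> A \<inter> B" using that \<open>W \<subseteq> A\<close> \<open>W' \<subseteq> B\<close> by (auto simp: edges_in_def)
        then have "e = {}" using dis by simp
        then show False using E[of e] that by (simp add: edges_in_def)
      qed
      then show ?thesis by blast
    qed
    moreover have "W \<inter> W' = {}" using that dis by auto
    ultimately show ?thesis
      using f by (simp add: prod.union_disjoint finite_edges_in mult_ac)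
  qed
  have "delta E q A k * delta E q B k =
     (\<Sum>(W, W')\<in>Pow A \<times> Pow B. prod q (edges_in E (W \<union> W')) * prod k (W \<union> W'))"
    unfolding delta_def sum_product sum.cartesian_product
    by (rule sum.cong) (auto simp: split)
  also have "\<dots> = delta E q (A \<union> B) k"
    unfolding delta_def
  proof (rule sum.reindex_bij_witness[where i = "\<lambda>W. (W \<inter> A, W \<inter> B)"
        and j = "\<lambda>p. fst p \<union> snd p"])
    show "((fst p \<union> snd p) \<inter> A, (fst p \<union> snd p) \<inter> B) = p" if "p \<in> Pow A \<times> Pow B" for p
      using that dis by (cases p) auto
  qed auto
  finally show ?thesis by simp
qed

lemma delta_UNION:
  assumes E: "\<And>e. e \<in> E \<Longrightarrow> card e = 2" and "finite I"
    and "\<And>i. i \<in> I \<Longrightarrow> finite (B i)"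
    and "\<And>i j. i \<in> I \<Longrightarrow> j \<in> I \<Longrightarrow> i \<noteq> j \<Longrightarrow> B i \<inter> B j = {}"
    and "\<And>i j x y. i \<in> I \<Longrightarrow> j \<in> I \<Longrightarrow> i \<noteq> j \<Longrightarrow> x \<in> B i \<Longrightarrow> y \<in> B j \<Longrightarrow> {x, y} \<notin> E"
  shows "delta E q (\<Union>i\<in>I. B i) k = (\<Prod>i\<in>I. delta E q (B i) k)"
  using assms(2-5)
proof (induction I rule: finite_induct)
  case empty
  then show ?case using delta_empty[OF E] by simp
next
  case (insert i I)
  have IH: "delta E q (\<Union>i\<in>I. B i) k = (\<Prod>i\<in>I. delta E q (B i) k)"
  proof (rule insert.IH)
    show "{x, y} \<notin> E" if "i' \<in> I" "j \<in> I" "i' \<noteq> j" "x \<in> B i'" "y \<in> B j" for i' j x y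
      using insert.prems(3)[of i' j x y] that by simp
  qed (use insert.prems(1,2) in auto)
  have ne: "j \<noteq> i" if "j \<in> I" for j using that insert.hyps by auto
  have "delta E q (B i \<union> (\<Union>i\<in>I. B i)) k = delta E q (B i) k * delta E q (\<Union>i\<in>I. B i) k"
  proof (rule delta_union[OF E])
    show "B i \<inter> (\<Union>i\<in>I. B i) = {}"
      using insert.prems(2)[of i] ne by blast
    show "{x, y} \<notin> E" if "x \<in> B i" "y \<in> (\<Union>i\<in>I. B i)" for x y
      using insert.prems(3)[of i _ x y] ne that by blast
  qed (use insert in auto)
  then show ?case using IH insert.hyps by simp
qed

section \<open>Recursion over subtrees\<close>

context rooted_tree
begin

lemma edge_card: "e \<in> E \<Longrightarrow> card e = 2"
  using tree_edge_card[OF tree] .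

lemma finite_cl [simp]: "v \<in> V \<Longrightarrow> finite (cl v)"
  using cl_subset finite_V by (rule finite_subset)

lemma finite_de [simp]: "v \<in> V \<Longrightarrow> finite (de v)"
  using de_subset finite_V by (rule finite_subset)

lemma delta_de: "delta E q (de v) k = (\<Prod>w\<in>ch v. delta E q (cl w) k)"
  unfolding de_eq
proof (rule delta_UNION)
  show "finite (cl i)" if "i \<in> ch v" for i
    using that ch_subset finite_cl by blast
qed (simp_all add: edge_card cl_disjoint no_edge_between_siblings)

text \<open>\<open>delta\<close> is affine in the single coordinate at \<open>w\<close>, and equals
  \<open>delta E q (de w) k\<close> where that coordinate vanishes; scaling it by \<open>t\<close>
  scales the increment.\<close>

lemma delta_cl_scale:
  assumes "w \<in> V" and k': "k' w = t * k w" "\<And>x. x \<in> de w \<Longrightarrow> k' x = k x"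
  shows "delta E q (cl w) k' = delta E q (de w) k + t * (delta E q (cl w) k - delta E q (de w) k)"
proof -
  have 1: "delta E q (de w) k' = delta E q (de w) k"
    by (rule delta_cong) (use k' in auto)
  have 2: "delta E q (de w) (\<lambda>x. (if {w, x} \<in> E then q {w, x} else 1) * k' x) =
      delta E q (de w) (\<lambda>x. (if {w, x} \<in> E then q {w, x} else 1) * k x)"
    by (rule delta_cong) (use k' in auto)
  have "cl w = insert w (de w)" by (simp add: closed_descendants_def)
  then show ?thesis
    by (simp only: delta_insert[OF edge_card finite_de[OF assms(1)] notin_de] 1 2 k'(1))
      (simp add: algebra_simps)
qed

text \<open>Reweighting by the edges at \<open>v\<close> changes, in each child subtree, only the
  coordinate of its top vertex, so \<open>delta_cl_scale\<close> applies with
  \<open>t = q {v, w}\<close>.\<close>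

lemma delta_cl:
  assumes v: "v \<in> V"
  shows "delta E q (cl v) k = delta E q (de v) k + k v *
    (\<Prod>w\<in>ch v. delta E q (de w) k + q {v, w} * (delta E q (cl w) k - delta E q (de w) k))"
proof -
  let ?k = "\<lambda>x. (if {v, x} \<in> E then q {v, x} else 1) * k x"
  have "delta E q (cl w) ?k =
      delta E q (de w) k + q {v, w} * (delta E q (cl w) k - delta E q (de w) k)"
    if w: "w \<in> ch v" for w
  proof (rule delta_cl_scale)
    show "w \<in> V" using w ch_subset by blast
    show "?k w = q {v, w} * k w" using w by (simp add: ch_def arc_edge)
    fix x assume x: "x \<in> de w"
    have "x \<in> cl w" using x by (simp add: closed_descendants_def)
    then have xv: "x \<in> de v" using w by (auto simp: de_eq)
    have "x \<notin> ch v"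
    proof
      assume xc: "x \<in> ch v"
      have "w \<noteq> x" using x by (auto simp: descendants_def)
      then have "cl w \<inter> cl x = {}" using cl_disjoint[OF w xc] by simp
      then show False using \<open>x \<in> cl w\<close> by (auto simp: closed_descendants_def)
    qed
    then have "{v, x} \<notin> E" using edge_to_de[OF xv] by simp
    then show "?k x = k x" by simp
  qed
  then have "delta E q (de v) ?k =
      (\<Prod>w\<in>ch v. delta E q (de w) k + q {v, w} * (delta E q (cl w) k - delta E q (de w) k))"
    unfolding delta_de by (intro prod.cong) (simp_all add: delta_de)
  moreover have "cl v = insert v (de v)" by (simp add: closed_descendants_def)
  ultimately show ?thesis
    by (simp only: delta_insert[OF edge_card finite_de[OF v] notin_de])
qed

end

section \<open>The change of variables and its inverse\<close>

locale tree_beta = rooted_tree V E r for V :: "'v set" and E r +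
  fixes q :: "'v set \<Rightarrow> real" and s :: real
  assumes sign_cases: "s = - 1 \<and> (\<forall>e\<in>E. q e < 1) \<or> s = 1 \<and> (\<forall>e\<in>E. 0 \<le> q e)"
begin

text \<open>The sign \<open>s\<close> is \<open>- 1\<close> for the laws of the first kind and \<open>1\<close> for those of the second;
  \<open>F\<close>, \<open>Y\<close>, \<open>I\<close> and \<open>D\<close> become \<open>\<Delta>\<close>, \<open>\<Psi>\<close>, \<open>(0,1)\<close>, \<open>\<D>\<close> and
  \<open>\<delta>\<close>, \<open>\<psi>\<close>, \<open>(0,\<infinity>)\<close>, \<open>(0,\<infinity>)\<^sup>V\<close> respectively. Outside \<open>I\<close> the factor \<open>h\<close> is
  set to \<open>1\<close> to keep it positive, which makes \<open>T\<close>, the inverse of \<open>Y\<close>, injective everywhere.\<close>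

definition I :: "real set" where "I = {x. 0 < x \<and> 0 < 1 + s * x}"
definition F :: "'v set \<Rightarrow> ('v \<Rightarrow> real) \<Rightarrow> real" where "F U k = delta E q U (\<lambda>v. s * k v)"
definition Y :: "'v \<Rightarrow> ('v \<Rightarrow> real) \<Rightarrow> real" where "Y v k = s * (F (cl v) k / F (de v) k - 1)"
definition D :: "('v \<Rightarrow> real) set" where "D = {k \<in> V \<rightarrow>\<^sub>E {0<..}. \<forall>U\<subseteq>V. 0 < F U k}"
text \<open>The root has no parent edge; the value 0 makes its factor
  \<open>1 + s * qp r * x\<close> equal to 1, so the root obeys the same formulas as the other
  vertices.\<close>

definition qp :: "'v \<Rightarrow> real" where "qp w = (if w = r then 0 else q {par w, w})"
definition h :: "'v \<Rightarrow> real \<Rightarrow> real" where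
  "h w x = (if x \<in> I then (1 + s * x) / (1 + s * qp w * x) else 1)"
definition T :: "('v \<Rightarrow> real) \<Rightarrow> 'v \<Rightarrow> real" where
  "T x = (\<lambda>v\<in>V. x v * (\<Prod>w\<in>ch v. h w (x w)))"

lemma ss [simp]: "s * s = 1" and s_ss [simp]: "s * (s * x) = x"
  using sign_cases by auto

lemma child_in_V: "w \<in> ch v \<Longrightarrow> w \<in> V"
  using ch_subset by blast

lemma qp_child: "w \<in> ch v \<Longrightarrow> qp w = q {v, w}"
  using no_arc_to_root by (auto simp: qp_def ch_def par_eq)

text \<open>For the negative sign, \<open>qp w < 1\<close> and \<open>0 < x < 1\<close> give
  \<open>qp w * x < x < 1\<close>, also when the weight is negative.\<close>

lemma denom_pos:
  assumes x: "x \<in> I" and w: "w \<in> V" shows "0 < 1 + s * qp w * x"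
  using sign_cases
proof
  assume s: "s = - 1 \<and> (\<forall>e\<in>E. q e < 1)"
  have "qp w < 1"
    using s w par_arc arc_edge by (auto simp: qp_def)
  moreover have "0 < x" "x < 1" using x s unfolding I_def by auto
  moreover have "x - qp w * x = x * (1 - qp w)" by (simp add: algebra_simps)
  ultimately have "qp w * x < x" by (metis diff_gt_0_iff_gt mult_pos_pos)
  then have "qp w * x < 1" using \<open>x < 1\<close> by simp
  then show ?thesis using s by simp
next
  assume s: "s = 1 \<and> (\<forall>e\<in>E. 0 \<le> q e)"
  have "0 \<le> qp w"
    using s w par_arc arc_edge by (auto simp: qp_def)
  moreover have "0 < x" using x by (simp add: I_def)
  ultimately show ?thesis using s by (simp add: add_pos_nonneg)
qed

lemma h_pos: "w \<in> V \<Longrightarrow> 0 < h w x"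
  using denom_pos by (auto simp: h_def I_def)

lemma F_de: "F (de v) k = (\<Prod>w\<in>ch v. F (cl w) k)"
  unfolding F_def by (rule delta_de)

lemma F_cl:
  "v \<in> V \<Longrightarrow> F (cl v) k = F (de v) k + s * k v *
    (\<Prod>w\<in>ch v. F (de w) k + qp w * (F (cl w) k - F (de w) k))"
  unfolding F_def by (simp add: delta_cl qp_child del: mult_cancel_left cong: prod.cong)

lemma F_cl_Y: "F (de v) k \<noteq> 0 \<Longrightarrow> F (cl v) k = F (de v) k * (1 + s * Y v k)"
  unfolding Y_def by (simp add: algebra_simps)

text \<open>Divide \<open>F_cl\<close> by \<open>F (de v) k\<close>, which is the product of the
  \<open>F (cl w) k\<close> over the children; cancelling \<open>F (de w) k\<close> turns each
  quotient into a function of \<open>Y w k\<close> alone. Nonvanishing is assumed instead of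
  \<open>k \<in> D\<close>, because \<open>F_pos_below\<close> applies the recursion to vectors with
  zero coordinates.\<close>

lemma Y_rec:
  assumes v: "v \<in> V" and nz: "\<And>w. w \<in> ch v \<Longrightarrow> F (cl w) k \<noteq> 0 \<and> F (de w) k \<noteq> 0"
  shows "Y v k = k v * (\<Prod>w\<in>ch v. (1 + s * qp w * Y w k) / (1 + s * Y w k))"
proof -
  let ?R = "\<lambda>w. F (de w) k + qp w * (F (cl w) k - F (de w) k)"
  have ratio: "(1 + s * qp w * Y w k) / (1 + s * Y w k) = ?R w / F (cl w) k" if w: "w \<in> ch v" for w
  proof -
    have nz': "F (de w) k \<noteq> 0" "F (cl w) k \<noteq> 0" using nz w by auto
    have 1: "1 + s * Y w k = F (cl w) k / F (de w) k"
      by (simp add: Y_def)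
    have "1 + s * qp w * Y w k = 1 + qp w * (s * Y w k)" by (simp add: mult_ac)
    also have "s * Y w k = F (cl w) k / F (de w) k - 1" using 1 by simp
    also have "1 + qp w * (F (cl w) k / F (de w) k - 1) = ?R w / F (de w) k"
      using nz' by (simp add: add_divide_distrib diff_divide_distrib right_diff_distrib)
    finally have "1 + s * qp w * Y w k = ?R w / F (de w) k" .
    then show ?thesis using 1 nz' by simp
  qed
  have nzd: "F (de v) k \<noteq> 0" unfolding F_de using nz by (simp add: prod_zero_iff)
  have "Y v k = k v * (\<Prod>w\<in>ch v. ?R w) / F (de v) k"
    unfolding Y_def F_cl[OF v] using nzd by (simp add: add_divide_distrib mult.assoc)
  also have "\<dots> = k v * (\<Prod>w\<in>ch v. ?R w / F (cl w) k)"
    unfolding F_de[of v] prod_dividef by simp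
  also have "\<dots> = k v * (\<Prod>w\<in>ch v. (1 + s * qp w * Y w k) / (1 + s * Y w k))"
    using ratio by simp
  finally show ?thesis .
qed

lemma D_pos:
  assumes "k \<in> D" "v \<in> V" shows "0 < k v" "0 < F (cl v) k" "0 < F (de v) k"
  using assms cl_subset de_subset by (auto simp: D_def PiE_iff)

lemma D_child_nonzero: "k \<in> D \<Longrightarrow> w \<in> ch v \<Longrightarrow> F (cl w) k \<noteq> 0 \<and> F (de w) k \<noteq> 0"
  using D_pos child_in_V by (metis less_irrefl)

text \<open>\<open>1 + s * Y v k\<close> is a ratio of positive values of \<open>F\<close>;
  positivity of \<open>Y v k\<close> follows from the recursion, whose child factors are positive by
  induction.\<close>

lemma Y_in_I: assumes k: "k \<in> D" and "v \<in> V" shows "Y v k \<in> I"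
  using assms(2)
proof (induction rule: child_induct)
  case (step v)
  have "0 < (1 + s * qp w * Y w k) / (1 + s * Y w k)" if "w \<in> ch v" for w
    using step.IH[OF that] denom_pos child_in_V[OF that] by (auto simp: I_def)
  then have "0 < (\<Prod>w\<in>ch v. (1 + s * qp w * Y w k) / (1 + s * Y w k))"
    by (intro prod_pos) auto
  moreover have "Y v k = k v * (\<Prod>w\<in>ch v. (1 + s * qp w * Y w k) / (1 + s * Y w k))"
    using step.hyps D_child_nonzero[OF k] by (rule Y_rec)
  ultimately have "0 < Y v k" using D_pos[OF k step.hyps] by simp
  moreover have "0 < 1 + s * Y v k"
    using F_cl_Y[of v k] D_pos[OF k step.hyps] by (simp add: zero_less_mult_iff)
  ultimately show ?case by (simp add: I_def)
qed

lemma T_Y: assumes k: "k \<in> D" shows "T (\<lambda>v\<in>V. Y v k) = k"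
proof
  fix v
  show "T (\<lambda>v\<in>V. Y v k) v = k v"
  proof (cases "v \<in> V")
    case True
    have rec: "Y v k = k v * (\<Prod>w\<in>ch v. (1 + s * qp w * Y w k) / (1 + s * Y w k))"
      using True D_child_nonzero[OF k] by (rule Y_rec)
    \<comment> \<open>Since \<open>Y w k \<in> I\<close>, the first branch of \<open>h\<close>
      applies and is the reciprocal of the recursion factor.\<close>
    have "(1 + s * qp w * Y w k) / (1 + s * Y w k) * h w (Y w k) = 1" if w: "w \<in> ch v" for w
    proof -
      have "w \<in> V" "Y w k \<in> I" using w child_in_V Y_in_I[OF k] by auto
      then show ?thesis using denom_pos[of "Y w k" w] by (auto simp: h_def I_def)
    qed
    then have one: "(\<Prod>w\<in>ch v. (1 + s * qp w * Y w k) / (1 + s * Y w k)) * (\<Prod>w\<in>ch v. h w (Y w k)) = 1"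
      unfolding prod.distrib[symmetric] by (intro prod.neutral ballI)
    have "T (\<lambda>v\<in>V. Y v k) v = Y v k * (\<Prod>w\<in>ch v. h w (Y w k))"
      using True by (simp add: T_def child_in_V cong: prod.cong)
    also have "\<dots> = k v"
      by (subst rec, subst mult.assoc, subst one) simp
    finally show ?thesis .
  next
    case False
    have "k \<in> extensional V" using k by (simp add: D_def PiE_iff)
    then show ?thesis using extensional_arb[OF _ False, of k] False by (simp add: T_def)
  qed
qed

section \<open>Injectivity and image of \<open>T\<close>\<close>

text \<open>Once the coordinates at the children of \<open>v\<close> agree, so do the nonzero
  products of \<open>h\<close>, which then cancel. This turns the one-sided inverse
  \<open>T_Y\<close> into \<open>Y_T\<close> and \<open>T_in_D_iff\<close>.\<close>

lemma T_inj:
  assumes "T x = T y" "x \<in> extensional V" "y \<in> extensional V" shows "x = y"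
proof (rule extensionalityI[OF assms(2,3)])
  fix v assume "v \<in> V"
  then show "x v = y v"
  proof (induction rule: child_induct)
    case (step v)
    have "(\<Prod>w\<in>ch v. h w (x w)) = (\<Prod>w\<in>ch v. h w (y w))"
      using step.IH by (intro prod.cong) auto
    moreover have "(\<Prod>w\<in>ch v. h w (y w)) \<noteq> 0"
      using child_in_V h_pos by (intro less_imp_neq[symmetric] prod_pos) auto
    ultimately show ?case
      using fun_cong[OF assms(1), of v] step.hyps by (simp add: T_def del: prod_zero_iff)
  qed
qed

lemma T_pos:
  assumes "x \<in> V \<rightarrow>\<^sub>E I" shows "T x \<in> V \<rightarrow>\<^sub>E {0<..}"
proof (rule PiE_I)
  fix v assume v: "v \<in> V"
  have "0 < (\<Prod>w\<in>ch v. h w (x w))" using child_in_V h_pos by (intro prod_pos) auto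
  moreover have "0 < x v" using assms v by (auto simp: PiE_iff I_def)
  ultimately show "T x v \<in> {0<..}" using v by (simp add: T_def)
qed (simp add: T_def)

text \<open>For negative sign, shrinking the coordinates of \<open>T x\<close> shrinks each \<open>Y v\<close>; setting
  coordinates to zero turns \<open>F V\<close> into \<open>F U\<close>.\<close>

lemma F_pos_below:
  assumes s: "s = - 1" and x: "x \<in> V \<rightarrow>\<^sub>E I"
    and k: "\<And>v. v \<in> V \<Longrightarrow> 0 \<le> k v \<and> k v \<le> T x v" and v: "v \<in> V"
  shows "0 < F (cl v) k \<and> 0 < F (de v) k \<and> 0 \<le> Y v k \<and> Y v k \<le> x v"
  using v
proof (induction rule: child_induct)
  case (step v)
  have de: "0 < F (de v) k" unfolding F_de using step.IH by (intro prod_pos) auto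
  have rec: "Y v k = k v * (\<Prod>w\<in>ch v. (1 + s * qp w * Y w k) / (1 + s * Y w k))"
    using step.hyps by (rule Y_rec) (use step.IH in force)
  have xI: "x w \<in> I" "0 < x w" "x w < 1" if "w \<in> V" for w
    using x that s unfolding PiE_iff I_def by auto
  have bound: "0 \<le> (1 + s * qp w * Y w k) / (1 + s * Y w k) \<and>
     (1 + s * qp w * Y w k) / (1 + s * Y w k) \<le> 1 / h w (x w)" if w: "w \<in> ch v" for w
  proof -
    have wV: "w \<in> V" using w child_in_V by auto
    have y: "0 \<le> Y w k" "Y w k \<le> x w" using step.IH[OF w] by auto
    have q1: "qp w < 1" using s sign_cases wV par_arc arc_edge by (auto simp: qp_def)
    have d: "0 < 1 - qp w * x w" using denom_pos[OF xI(1)[OF wV] wV] s by simp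
    have yp: "0 < 1 - qp w * Y w k"
    proof (cases "qp w \<le> 0")
      case True
      then have "qp w * Y w k \<le> 0" using y by (simp add: mult_nonpos_nonneg)
      then show ?thesis by simp
    next
      case False
      then have "qp w * Y w k \<le> qp w * x w" using y by (intro mult_left_mono) auto
      then show ?thesis using d by simp
    qed
    \<comment> \<open>Cleared of denominators, this says that
      \<open>(1 - qp w * t) / (1 - t)\<close> is increasing in t, because
      \<open>qp w < 1\<close>.\<close>
    have "(1 - qp w * Y w k) * (1 - x w) \<le> (1 - qp w * x w) * (1 - Y w k)"
    proof -
      have "(1 - qp w * x w) * (1 - Y w k) - (1 - qp w * Y w k) * (1 - x w)
          = (1 - qp w) * (x w - Y w k)" by (simp add: algebra_simps)
      also have "\<dots> \<ge> 0" using q1 y by (intro mult_nonneg_nonneg) auto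
      finally show ?thesis by simp
    qed
    then have "(1 - qp w * Y w k) / (1 - Y w k) \<le> (1 - qp w * x w) / (1 - x w)"
      using y xI(2,3)[OF wV] by (simp add: divide_simps)
    moreover have "h w (x w) = (1 + s * x w) / (1 + s * qp w * x w)"
      using xI(1)[OF wV] by (simp add: h_def)
    then have "1 / h w (x w) = (1 - qp w * x w) / (1 - x w)"
      by (simp add: s)
    ultimately show ?thesis using s yp y xI(3)[OF wV] by simp
  qed
  have P0: "0 \<le> (\<Prod>w\<in>ch v. (1 + s * qp w * Y w k) / (1 + s * Y w k))"
    using bound by (intro prod_nonneg) auto
  have P1: "(\<Prod>w\<in>ch v. (1 + s * qp w * Y w k) / (1 + s * Y w k)) \<le> (\<Prod>w\<in>ch v. 1 / h w (x w))"
    using bound by (intro prod_mono) auto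
  have H: "0 < (\<Prod>w\<in>ch v. h w (x w))" using child_in_V h_pos by (intro prod_pos) auto
  have kv: "0 \<le> k v" "k v \<le> T x v" using k step.hyps by auto
  have Y0: "0 \<le> Y v k" unfolding rec using P0 kv by simp
  have "Y v k \<le> T x v * (\<Prod>w\<in>ch v. 1 / h w (x w))"
    unfolding rec using P0 P1 kv by (intro mult_mono) auto
  also have "\<dots> = x v"
    using less_imp_neq[OF H] step.hyps by (simp add: T_def prod_dividef del: prod_zero_iff)
  finally have Yx: "Y v k \<le> x v" .
  \<comment> \<open>Since \<open>Y v k \<le> x v < 1\<close>, positivity passes from
    \<open>de v\<close> to \<open>cl v\<close>.\<close>
  have "F (cl v) k = F (de v) k * (1 + s * Y v k)" using de by (intro F_cl_Y) auto
  also have "\<dots> > 0" using de Yx xI(3)[OF step.hyps] s by simp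
  finally show ?case using de Y0 Yx by simp
qed

lemma F_pos_of_pos:
  assumes s: "s = 1" and U: "U \<subseteq> V" and k: "\<And>v. v \<in> V \<Longrightarrow> 0 < k v"
  shows "0 < F U k"
proof -
  have qn: "\<forall>e\<in>E. 0 \<le> q e" using sign_cases s by auto
  have "0 < (\<Sum>W\<in>Pow U. prod q (edges_in E W) * prod k W)"
  proof (rule sum_pos2[of _ "{}"])
    show "finite (Pow U)" using U finite_V by (simp add: finite_subset)
    have "edges_in E {} = {}" using edge_card[of "{}"] by (auto simp: edges_in_def)
    then show "0 < prod q (edges_in E {}) * prod k {}" by simp
    show "0 \<le> prod q (edges_in E W) * prod k W" if "W \<in> Pow U" for W
    proof (intro mult_nonneg_nonneg prod_nonneg)
      show "0 \<le> q e" if "e \<in> edges_in E W" for e using that qn by (simp add: edges_in_def)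
      show "0 \<le> k v" if "v \<in> W" for v
        using k[of v] that \<open>W \<in> Pow U\<close> U by auto
    qed
  qed auto
  then show ?thesis unfolding F_def delta_def using s by simp
qed

lemma T_in_D: assumes x: "x \<in> V \<rightarrow>\<^sub>E I" shows "T x \<in> D"
proof -
  have pos: "0 < T x v" if "v \<in> V" for v using T_pos[OF x] that by (auto simp: PiE_iff)
  have "0 < F U (T x)" if U: "U \<subseteq> V" for U
    using sign_cases
  proof
    assume s: "s = 1 \<and> (\<forall>e\<in>E. 0 \<le> q e)"
    show ?thesis using F_pos_of_pos U pos s by blast
  next
    assume s: "s = - 1 \<and> (\<forall>e\<in>E. q e < 1)"
    let ?k = "\<lambda>v. if v \<in> U then T x v else 0"
    have "0 \<le> ?k v \<and> ?k v \<le> T x v" if "v \<in> V" for v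
      using pos[OF that] by simp
    then have "0 < F (cl r) ?k"
      using F_pos_below[OF _ x _ root, of ?k] s by blast
    moreover have "F U (T x) = F V ?k"
      unfolding F_def delta_restrict[OF finite_V U]
      by (rule arg_cong[where f = "delta E q V"]) auto
    ultimately show ?thesis by (simp add: cl_root)
  qed
  then show ?thesis using T_pos[OF x] by (simp add: D_def)
qed

lemma Y_T: assumes x: "x \<in> V \<rightarrow>\<^sub>E I" shows "(\<lambda>v\<in>V. Y v (T x)) = x"
  by (rule T_inj) (use T_Y[OF T_in_D[OF x]] x in \<open>auto simp: PiE_iff\<close>)

text \<open>If \<open>T x\<close> lies in \<open>D\<close>, then \<open>x\<close> and the point
  recovered by \<open>Y\<close> have the same image under \<open>T\<close>, so they coincide and
  \<open>x\<close> has its coordinates in \<open>I\<close>.\<close>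

lemma T_in_D_iff:
  assumes "x \<in> extensional V" shows "T x \<in> D \<longleftrightarrow> x \<in> V \<rightarrow>\<^sub>E I"
proof
  assume "T x \<in> D"
  then have "T (\<lambda>v\<in>V. Y v (T x)) = T x" "(\<lambda>v\<in>V. Y v (T x)) \<in> V \<rightarrow>\<^sub>E I"
    using T_Y Y_in_I by auto
  then show "x \<in> V \<rightarrow>\<^sub>E I" using T_inj assms by (metis PiE_iff)
qed (rule T_in_D)

text \<open>The product of all \<open>F (cl v)\<close> equals that of all \<open>F (de v)\<close> times
  \<open>\<Prod>v. 1 + s * x v\<close>, and the two products differ only in the factor \<open>F (cl r) = F V\<close>.\<close>

lemma F_V_T: assumes x: "x \<in> V \<rightarrow>\<^sub>E I" shows "F V (T x) = (\<Prod>v\<in>V. 1 + s * x v)"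
proof -
  let ?k = "T x"
  have k: "?k \<in> D" using x by (rule T_in_D)
  have Yx: "Y v ?k = x v" if "v \<in> V" for v
    using fun_cong[OF Y_T[OF x], of v] that by simp
  have "(\<Prod>v\<in>V. F (cl v) ?k) = (\<Prod>v\<in>V. F (de v) ?k) * (\<Prod>v\<in>V. 1 + s * x v)"
    unfolding prod.distrib[symmetric]
  proof (rule prod.cong[OF refl])
    fix v assume v: "v \<in> V"
    show "F (cl v) ?k = F (de v) ?k * (1 + s * x v)"
      using F_cl_Y[of v ?k] D_pos[OF k v] Yx[OF v] by simp
  qed
  moreover have "(\<Prod>v\<in>V. F (de v) ?k) = (\<Prod>w\<in>V - {r}. F (cl w) ?k)"
    unfolding F_de by (rule prod_ch)
  moreover have "(\<Prod>v\<in>V. F (cl v) ?k) = F V ?k * (\<Prod>w\<in>V - {r}. F (cl w) ?k)"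
    using root by (simp add: prod.remove cl_root)
  moreover have "(\<Prod>w\<in>V - {r}. F (cl w) ?k) \<noteq> 0"
    using D_pos[OF k] by (intro less_imp_neq[symmetric] prod_pos) auto
  ultimately show ?thesis by (simp del: prod_zero_iff)
qed

end

section \<open>Triangular scalings and normalised densities\<close>

lemma product_sigma_finite_lborel: "product_sigma_finite (\<lambda>_. lborel :: real measure)"
  by (simp add: product_sigma_finite_def sigma_finite_lborel)

lemma measurable_coordinate:
  "w \<in> W \<Longrightarrow> (\<lambda>x. x w) \<in> borel_measurable (Pi\<^sub>M W (\<lambda>_. lborel :: real measure))"
  using measurable_component_singleton[of w W "\<lambda>_. lborel :: real measure"] by simp

lemma measurable_triangular:
  fixes h :: "'v \<Rightarrow> real \<Rightarrow> real"
  assumes "\<And>v. v \<in> W \<Longrightarrow> ch v \<subseteq> W" "\<And>w. w \<in> W \<Longrightarrow> h w \<in> borel_measurable borel"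
  shows "v \<in> W \<Longrightarrow> (\<lambda>x. \<Prod>w\<in>ch v. h w (x w)) \<in> borel_measurable (Pi\<^sub>M W (\<lambda>_. lborel))"
    and "(\<lambda>x. \<lambda>v\<in>W. x v * (\<Prod>w\<in>ch v. h w (x w)))
      \<in> measurable (Pi\<^sub>M W (\<lambda>_. lborel)) (Pi\<^sub>M W (\<lambda>_. lborel))"
proof -
  have prod: "(\<lambda>x. \<Prod>w\<in>ch v. h w (x w)) \<in> borel_measurable (Pi\<^sub>M W (\<lambda>_. lborel))"
    if v: "v \<in> W" for v
  proof (rule borel_measurable_prod)
    fix w assume "w \<in> ch v"
    then have w: "w \<in> W" using assms(1)[OF v] by auto
    show "(\<lambda>x. h w (x w)) \<in> borel_measurable (Pi\<^sub>M W (\<lambda>_. lborel))"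
      using measurable_compose[OF measurable_coordinate[OF w] assms(2)[OF w]] .
  qed
  show "v \<in> W \<Longrightarrow> (\<lambda>x. \<Prod>w\<in>ch v. h w (x w)) \<in> borel_measurable (Pi\<^sub>M W (\<lambda>_. lborel))"
    by (rule prod)
  show "(\<lambda>x. \<lambda>v\<in>W. x v * (\<Prod>w\<in>ch v. h w (x w)))
      \<in> measurable (Pi\<^sub>M W (\<lambda>_. lborel)) (Pi\<^sub>M W (\<lambda>_. lborel))"
    by (rule measurable_restrict) (simp add: borel_measurable_times measurable_coordinate prod)
qed

text \<open>A coordinate of minimal rank does not enter any of the scaling factors, so it can be
  integrated first, over a one-dimensional scaling.\<close>

lemma nn_integral_triangular_scaling:
  fixes h :: "'v \<Rightarrow> real \<Rightarrow> real" and rk :: "'v \<Rightarrow> nat"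
  assumes "finite W" "\<And>v. v \<in> W \<Longrightarrow> ch v \<subseteq> {w \<in> W. rk v < rk w}"
    and "\<And>w. w \<in> W \<Longrightarrow> h w \<in> borel_measurable borel" "\<And>w t. w \<in> W \<Longrightarrow> 0 < h w t"
    and "f \<in> borel_measurable (Pi\<^sub>M W (\<lambda>_. lborel))"
  shows "(\<integral>\<^sup>+x. f x \<partial>Pi\<^sub>M W (\<lambda>_. lborel)) =
    (\<integral>\<^sup>+x. ennreal (\<Prod>v\<in>W. \<Prod>w\<in>ch v. h w (x w)) *
      f (\<lambda>v\<in>W. x v * (\<Prod>w\<in>ch v. h w (x w))) \<partial>Pi\<^sub>M W (\<lambda>_. lborel))"
  using assms
proof (induction W arbitrary: f rule: finite_psubset_induct)
  case (psubset W)
  interpret product_sigma_finite "\<lambda>_ :: 'v. lborel :: real measure"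
    by (rule product_sigma_finite_lborel)
  show ?case
  proof (cases "W = {}")
    case True
    then show ?thesis
      by (simp add: PiM_empty nn_integral_count_space_finite restrict_def)
  next
    case False
    obtain v where v: "v \<in> W" and min: "\<And>u. u \<in> W \<Longrightarrow> rk v \<le> rk u"
      using ex_min_if_finite[of "rk ` W"] psubset.hyps False
      by (metis (no_types, lifting) finite_imageI image_iff image_is_empty leI)
    define U where "U = W - {v}"
    have W: "W = insert v U" and U: "finite U" "v \<notin> U" "U \<subset> W"
      using v psubset.hyps by (auto simp: U_def)
    define c where "c u x = (\<Prod>w\<in>ch u. h w (x w))" for u and x :: "'v \<Rightarrow> real"
    define S where "S B x = (\<lambda>u\<in>B. x u * c u x)" for B x
    \<comment> \<open>A child of \<open>u\<close> has rank above \<open>rk u \<ge> rk v\<close>, so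
      \<open>v\<close> is nobody's child.\<close>
    have chU: "ch u \<subseteq> {w \<in> U. rk u < rk w}" if "u \<in> W" for u
      using psubset.prems(1)[OF that] min[OF that] by (auto simp: U_def)
    have c_upd: "c u (x(v := t)) = c u x" if "u \<in> W" for u x t
      unfolding c_def using chU[OF that] U by (intro prod.cong) auto
    have c_pos: "0 < c u x" if "u \<in> W" for u x
      unfolding c_def using chU[OF that] U psubset.prems(3) by (intro prod_pos) auto
    \<comment> \<open>Changing the coordinate \<open>v\<close> leaves the other scaled coordinates
      alone. The summand 0 is the translation part of the affine substitution behind
      \<open>inner\<close>.\<close>
    have S_upd: "S W (x(v := t)) = (S U x)(v := 0 + c v x * t)" for x t
      using c_upd U by (auto simp: S_def W fun_eq_iff)
    have C_upd: "(\<Prod>u\<in>W. c u (x(v := t))) = c v x * (\<Prod>u\<in>U. c u x)" for x t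
      using U c_upd by (simp add: W)
    have mh: "h w \<in> borel_measurable borel" if "w \<in> U" for w
      using psubset.prems(2) that U by auto
    have mS: "S U \<in> measurable (Pi\<^sub>M U (\<lambda>_. lborel)) (Pi\<^sub>M U (\<lambda>_. lborel))"
      unfolding S_def c_def by (rule measurable_triangular(2)) (use chU U mh in auto)
    have mSW: "S W \<in> measurable (Pi\<^sub>M W (\<lambda>_. lborel)) (Pi\<^sub>M W (\<lambda>_. lborel))"
      unfolding S_def c_def by (rule measurable_triangular(2)) (use psubset.prems in blast)+
    have mcW: "c u \<in> borel_measurable (Pi\<^sub>M W (\<lambda>_. lborel))" if "u \<in> W" for u
      unfolding c_def by (rule measurable_triangular(1)[OF _ _ that]) (use psubset.prems in blast)+
    have mf: "f \<in> borel_measurable (Pi\<^sub>M (insert v U) (\<lambda>_. lborel))"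
      using psubset.prems(4) by (simp add: W)
    have mJ: "(\<lambda>(y, t). f (y(v := t))) \<in> borel_measurable (Pi\<^sub>M U (\<lambda>_. lborel) \<Otimes>\<^sub>M lborel)"
    proof -
      have "(\<lambda>(y, t). y(v := t)) \<in> measurable (Pi\<^sub>M U (\<lambda>_. lborel) \<Otimes>\<^sub>M lborel)
          (Pi\<^sub>M (insert v U) (\<lambda>_. lborel :: real measure))"
        by (rule measurable_add_dim)
      from measurable_compose[OF this mf] show ?thesis by (simp add: case_prod_unfold)
    qed
    have mfx: "(\<lambda>t. f (x(v := t))) \<in> borel_measurable borel"
      if "x \<in> space (Pi\<^sub>M U (\<lambda>_. lborel :: real measure))" for x
      using measurable_Pair2[OF mJ that] by simp
    define G where "G y = (\<integral>\<^sup>+t. f (y(v := t)) \<partial>lborel)" for y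
    have mG: "G \<in> borel_measurable (Pi\<^sub>M U (\<lambda>_. lborel))"
      unfolding G_def
      by (rule sigma_finite_measure.borel_measurable_nn_integral[OF sigma_finite_lborel mJ])
    have inner: "(\<integral>\<^sup>+t. ennreal (c v x * (\<Prod>u\<in>U. c u x)) * f ((S U x)(v := 0 + c v x * t)) \<partial>lborel)
        = ennreal (\<Prod>u\<in>U. c u x) * G (S U x)"
      if x: "x \<in> space (Pi\<^sub>M U (\<lambda>_. lborel :: real measure))" for x
    proof -
      have Sx: "S U x \<in> space (Pi\<^sub>M U (\<lambda>_. lborel))"
        using measurable_space[OF mS x] .
      have m: "(\<lambda>t. f ((S U x)(v := 0 + c v x * t))) \<in> borel_measurable lborel"
        using measurable_compose[OF _ mfx[OF Sx], of "\<lambda>t. 0 + c v x * t" lborel] by simp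
      have pos: "0 < c v x" "0 \<le> (\<Prod>u\<in>U. c u x)"
        using c_pos[OF v] less_imp_le[OF c_pos] by (simp_all add: W prod_nonneg)
      have "G (S U x) = ennreal (c v x) * (\<integral>\<^sup>+t. f ((S U x)(v := 0 + c v x * t)) \<partial>lborel)"
        unfolding G_def using nn_integral_real_affine[OF mfx[OF Sx], of "c v x" 0] pos by simp
      then show ?thesis
        unfolding nn_integral_cmult[OF m] using pos by (simp add: ennreal_mult mult_ac)
    qed
    have IH: "(\<integral>\<^sup>+x. G x \<partial>Pi\<^sub>M U (\<lambda>_. lborel)) =
        (\<integral>\<^sup>+x. ennreal (\<Prod>u\<in>U. c u x) * G (S U x) \<partial>Pi\<^sub>M U (\<lambda>_. lborel))"
      unfolding c_def S_def
    proof (rule psubset.IH[OF U(3)])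
      show "ch u \<subseteq> {w \<in> U. rk u < rk w}" if "u \<in> U" for u using chU that U by blast
    qed (use psubset.prems U mG in auto)
    have "(\<integral>\<^sup>+x. f x \<partial>Pi\<^sub>M W (\<lambda>_. lborel)) = (\<integral>\<^sup>+x. G x \<partial>Pi\<^sub>M U (\<lambda>_. lborel))"
      unfolding W G_def by (rule product_nn_integral_insert[OF U(1,2) mf])
    also note IH
    also have "(\<integral>\<^sup>+x. ennreal (\<Prod>u\<in>U. c u x) * G (S U x) \<partial>Pi\<^sub>M U (\<lambda>_. lborel)) =
        (\<integral>\<^sup>+x. (\<integral>\<^sup>+t. ennreal (\<Prod>u\<in>W. c u (x(v := t))) * f (S W (x(v := t))) \<partial>lborel)
          \<partial>Pi\<^sub>M U (\<lambda>_. lborel))"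
      unfolding C_upd S_upd by (rule nn_integral_cong) (rule inner[symmetric])
    also have "\<dots> = (\<integral>\<^sup>+x. ennreal (\<Prod>u\<in>W. c u x) * f (S W x) \<partial>Pi\<^sub>M W (\<lambda>_. lborel))"
    proof -
      have "(\<lambda>x. ennreal (\<Prod>u\<in>W. c u x) * f (S W x)) \<in> borel_measurable (Pi\<^sub>M W (\<lambda>_. lborel))"
        using mcW measurable_compose[OF mSW psubset.prems(4)]
        by (intro borel_measurable_times_ennreal measurable_compose[OF _ measurable_ennreal]
            borel_measurable_prod) auto
      then show ?thesis
        unfolding W by (subst product_nn_integral_insert[OF U(1,2)]) auto
    qed
    finally show ?thesis unfolding c_def S_def .
  qed
qed

section \<open>Normalised densities and product laws\<close>

lemma emeasure_law_prop_space:
  assumes "f \<in> borel_measurable N" shows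
    "emeasure (law_prop N f) (space N) = (\<integral>\<^sup>+x. ennreal (f x) \<partial>N) / (\<integral>\<^sup>+x. ennreal (f x) \<partial>N)"
proof -
  have m: "(\<lambda>x. ennreal (f x)) \<in> borel_measurable N" using assms by measurable
  have "emeasure (law_prop N f) (space N) =
      (\<integral>\<^sup>+x. ennreal (f x) / (\<integral>\<^sup>+y. ennreal (f y) \<partial>N) \<partial>N)"
    unfolding law_prop_def using m
    by (subst emeasure_density) (auto intro!: nn_integral_cong borel_measurable_divide_ennreal)
  also have "\<dots> = (\<integral>\<^sup>+x. ennreal (f x) \<partial>N) / (\<integral>\<^sup>+x. ennreal (f x) \<partial>N)"
    by (rule nn_integral_divide[OF m])
  finally show ?thesis .
qed

text \<open>The total mass is the integral divided by itself, which in the extended nonnegative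
  reals is 0 both for integral 0 and for integral \<infinity>.\<close>

lemma prob_space_law_prop_iff:
  assumes "f \<in> borel_measurable N"
  shows "prob_space (law_prop N f) \<longleftrightarrow>
    (\<integral>\<^sup>+x. ennreal (f x) \<partial>N) \<noteq> 0 \<and> (\<integral>\<^sup>+x. ennreal (f x) \<partial>N) \<noteq> \<top>"
proof -
  let ?Z = "\<integral>\<^sup>+x. ennreal (f x) \<partial>N"
  have "prob_space (law_prop N f) \<longleftrightarrow> emeasure (law_prop N f) (space N) = 1"
    using prob_space.emeasure_space_1[of "law_prop N f"] prob_spaceI[of "law_prop N f"]
    by (auto simp: law_prop_def)
  also have "\<dots> \<longleftrightarrow> ?Z / ?Z = 1" by (simp add: emeasure_law_prop_space[OF assms])
  also have "\<dots> \<longleftrightarrow> ?Z \<noteq> 0 \<and> ?Z \<noteq> \<top>"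
    by (cases "?Z = 0 \<or> ?Z = \<top>") (auto simp: ennreal_divide_self less_top)
  finally show ?thesis .
qed

lemma PiM_law_prop:
  fixes \<phi> :: "'v \<Rightarrow> real \<Rightarrow> real"
  assumes fin: "finite V" and m: "\<And>v. v \<in> V \<Longrightarrow> \<phi> v \<in> borel_measurable borel"
    and p: "\<And>v. v \<in> V \<Longrightarrow> prob_space (law_prop lborel (\<phi> v))"
  shows "(\<Pi>\<^sub>M v\<in>V. law_prop lborel (\<phi> v)) = density (\<Pi>\<^sub>M v\<in>V. lborel)
    (\<lambda>x. \<Prod>v\<in>V. ennreal (\<phi> v (x v)) / (\<integral>\<^sup>+y. ennreal (\<phi> v y) \<partial>lborel))"
proof -
  interpret L: product_sigma_finite "\<lambda>_ :: 'v. lborel :: real measure"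
    by (rule product_sigma_finite_lborel)
  \<comment> \<open>The product construction asks for a sigma-finite measure at every index, hence
    the default \<open>lborel\<close> outside \<open>V\<close>.\<close>
  define L' where "L' v = (if v \<in> V then law_prop lborel (\<phi> v) else lborel)" for v
  define \<rho> where "\<rho> v x = ennreal (\<phi> v x) / (\<integral>\<^sup>+y. ennreal (\<phi> v y) \<partial>lborel)" for v x
  have m\<rho>: "\<rho> v \<in> borel_measurable borel" if "v \<in> V" for v
    unfolding \<rho>_def using m[OF that] by measurable
  have "sigma_finite_measure (L' v)" for v
    using p by (auto simp: L'_def sigma_finite_lborel prob_space_imp_sigma_finite)
  then interpret L': product_sigma_finite L' by (simp add: product_sigma_finite_def)
  have sets_L': "sets (L' v) = sets borel" for v by (auto simp: L'_def law_prop_def)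
  have sets: "sets (Pi\<^sub>M V L') = sets (\<Pi>\<^sub>M v\<in>V. lborel)"
    by (rule sets_PiM_cong) (auto simp: sets_L')
  have mx: "(\<lambda>x. \<rho> v (x v)) \<in> borel_measurable (\<Pi>\<^sub>M v\<in>V. lborel)" if "v \<in> V" for v
    using measurable_compose[OF measurable_coordinate[OF that] m\<rho>[OF that]] .
  have "density (\<Pi>\<^sub>M v\<in>V. lborel) (\<lambda>x. \<Prod>v\<in>V. \<rho> v (x v)) = Pi\<^sub>M V L'"
  proof (rule L'.PiM_eqI[OF fin])
    fix A assume A: "\<And>v. v \<in> V \<Longrightarrow> A v \<in> sets (L' v)"
    then have A': "A v \<in> sets borel" if "v \<in> V" for v using that by (simp add: sets_L')
    have "emeasure (density (\<Pi>\<^sub>M v\<in>V. lborel) (\<lambda>x. \<Prod>v\<in>V. \<rho> v (x v))) (Pi\<^sub>E V A) =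
        (\<integral>\<^sup>+x. (\<Prod>v\<in>V. \<rho> v (x v)) * indicator (Pi\<^sub>E V A) x \<partial>(\<Pi>\<^sub>M v\<in>V. lborel))"
      using mx A' fin by (intro emeasure_density borel_measurable_prod_ennreal sets_PiM_I_finite) auto
    also have "\<dots> = (\<integral>\<^sup>+x. (\<Prod>v\<in>V. \<rho> v (x v) * indicator (A v) (x v)) \<partial>(\<Pi>\<^sub>M v\<in>V. lborel))"
    proof (rule nn_integral_cong)
      fix x assume "x \<in> space (\<Pi>\<^sub>M v\<in>V. lborel :: real measure)"
      then have "x \<in> Pi\<^sub>E V A \<longleftrightarrow> (\<forall>v\<in>V. x v \<in> A v)" by (auto simp: space_PiM PiE_iff)
      moreover have "(\<Prod>v\<in>V. indicator (A v) (x v)) = (if \<forall>v\<in>V. x v \<in> A v then 1 else 0 :: ennreal)"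
        using fin by (auto simp: indicator_def prod_zero_iff intro!: prod.neutral)
      ultimately have "(indicator (Pi\<^sub>E V A) x :: ennreal) = (\<Prod>v\<in>V. indicator (A v) (x v))"
        by (simp add: indicator_def)
      then show "(\<Prod>v\<in>V. \<rho> v (x v)) * indicator (Pi\<^sub>E V A) x = (\<Prod>v\<in>V. \<rho> v (x v) * indicator (A v) (x v))"
        by (simp add: prod.distrib)
    qed
    also have "\<dots> = (\<Prod>v\<in>V. \<integral>\<^sup>+x. \<rho> v x * indicator (A v) x \<partial>lborel)"
      using m\<rho> A' by (intro L.product_nn_integral_prod[OF fin]) auto
    also have "\<dots> = (\<Prod>v\<in>V. emeasure (L' v) (A v))"
      using m\<rho> A' by (intro prod.cong) (auto simp: L'_def law_prop_def \<rho>_def[symmetric] emeasure_density)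
    finally show "emeasure (density (\<Pi>\<^sub>M v\<in>V. lborel) (\<lambda>x. \<Prod>v\<in>V. \<rho> v (x v))) (Pi\<^sub>E V A) =
      (\<Prod>v\<in>V. emeasure (L' v) (A v))" .
  qed (simp add: sets)
  also have "Pi\<^sub>M V L' = (\<Pi>\<^sub>M v\<in>V. law_prop lborel (\<phi> v))"
    by (rule PiM_cong) (auto simp: L'_def)
  finally show ?thesis by (simp add: \<rho>_def)
qed

lemma ennreal_prod_degenerate:
  fixes z :: "'v \<Rightarrow> ennreal"
  assumes "finite V" shows "(\<Prod>v\<in>V. z v) \<noteq> 0 \<and> (\<Prod>v\<in>V. z v) \<noteq> \<top> \<longleftrightarrow> (\<forall>v\<in>V. z v \<noteq> 0 \<and> z v \<noteq> \<top>)"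
  using assms by (auto simp: ennreal_prod_eq_top prod_zero_iff)

text \<open>Finiteness excludes the product of 0 and \<infinity>, at which inversion is not
  multiplicative.\<close>

lemma ennreal_prod_inverse:
  fixes z :: "'v \<Rightarrow> ennreal"
  assumes "finite V" "\<And>v. v \<in> V \<Longrightarrow> z v \<noteq> \<top>"
  shows "(\<Prod>v\<in>V. inverse (z v)) = inverse (\<Prod>v\<in>V. z v)"
  using assms
proof (induction V rule: finite_induct)
  case (insert v V)
  then have "(\<Prod>v\<in>V. z v) \<noteq> \<top>" by (auto simp: ennreal_prod_eq_top)
  with insert show ?case by (simp add: ennreal_inverse_mult less_top)
qed simp

text \<open>In the nondegenerate case the law with density \<open>g\<close> is the image under
  \<open>T\<close> of the product law, while the right-hand side says that the vector of all
  \<open>Y v (K \<omega>)\<close> has that product law. \<open>T_Y\<close> inverts at every outcome,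
  \<open>Y_T\<close> wherever the product density is nonzero, which is almost everywhere for the
  product law.\<close>

lemma law_transport:
  fixes \<phi> :: "'v \<Rightarrow> real \<Rightarrow> real" and g :: "('v \<Rightarrow> real) \<Rightarrow> real"
    and T :: "('v \<Rightarrow> real) \<Rightarrow> 'v \<Rightarrow> real" and Y :: "'v \<Rightarrow> ('v \<Rightarrow> real) \<Rightarrow> real"
  assumes M: "prob_space M" and K: "K \<in> measurable M (\<Pi>\<^sub>M v\<in>V. borel)"
    and fin: "finite V" and ne: "V \<noteq> {}"
    and m\<phi>: "\<And>v. v \<in> V \<Longrightarrow> \<phi> v \<in> borel_measurable borel"
    and mg: "g \<in> borel_measurable (\<Pi>\<^sub>M v\<in>V. lborel)"
    and mT: "T \<in> measurable (\<Pi>\<^sub>M v\<in>V. lborel) (\<Pi>\<^sub>M v\<in>V. lborel)"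
    and mY: "\<And>v. v \<in> V \<Longrightarrow> Y v \<in> borel_measurable (\<Pi>\<^sub>M v\<in>V. borel)"
    and change: "\<And>f. f \<in> borel_measurable (\<Pi>\<^sub>M v\<in>V. lborel) \<Longrightarrow>
      (\<integral>\<^sup>+k. f k * ennreal (g k) \<partial>(\<Pi>\<^sub>M v\<in>V. lborel)) =
      (\<integral>\<^sup>+x. f (T x) * (\<Prod>v\<in>V. ennreal (\<phi> v (x v))) \<partial>(\<Pi>\<^sub>M v\<in>V. lborel))"
    and Y_T: "\<And>x. x \<in> extensional V \<Longrightarrow> (\<And>v. v \<in> V \<Longrightarrow> \<phi> v (x v) \<noteq> 0) \<Longrightarrow> (\<lambda>v\<in>V. Y v (T x)) = x"
    and T_Y: "\<And>\<omega>. \<omega> \<in> space M \<Longrightarrow> T (\<lambda>v\<in>V. Y v (K \<omega>)) = K \<omega>"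
  shows "distr M (\<Pi>\<^sub>M v\<in>V. borel) K = law_prop (\<Pi>\<^sub>M v\<in>V. lborel) g \<longleftrightarrow>
    prob_space.indep_vars M (\<lambda>_. borel) (\<lambda>v \<omega>. Y v (K \<omega>)) V \<and>
    (\<forall>v\<in>V. distr M borel (\<lambda>\<omega>. Y v (K \<omega>)) = law_prop lborel (\<phi> v))"
proof -
  interpret M: prob_space M by (rule M)
  interpret L: product_sigma_finite "\<lambda>_ :: 'v. lborel :: real measure"
    by (rule product_sigma_finite_lborel)
  let ?N = "\<Pi>\<^sub>M v\<in>V. lborel :: real measure"
  let ?B = "\<Pi>\<^sub>M v\<in>V. borel :: real measure"
  let ?P = "\<Pi>\<^sub>M v\<in>V. law_prop lborel (\<phi> v)"
  define z where "z v = (\<integral>\<^sup>+y. ennreal (\<phi> v y) \<partial>lborel)" for v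
  define Z where "Z = (\<integral>\<^sup>+k. ennreal (g k) \<partial>?N)"
  define S where "S k = (\<lambda>v\<in>V. Y v k)" for k
  have sets_NB: "sets ?N = sets ?B" by (rule sets_PiM_cong) auto
  have mS: "S \<in> measurable ?B ?B"
    unfolding S_def by (rule measurable_restrict) (rule mY)
  have mSK: "(\<lambda>\<omega>. S (K \<omega>)) \<in> measurable M ?B"
    using measurable_compose[OF K mS] .
  have mT': "T \<in> measurable ?B ?B"
    using mT by (simp cong: measurable_cong_sets add: sets_NB)
  have rv: "(\<lambda>\<omega>. Y v (K \<omega>)) \<in> borel_measurable M" if "v \<in> V" for v
    using measurable_compose[OF K mY[OF that]] .
  have mx: "(\<lambda>x. ennreal (\<phi> v (x v))) \<in> borel_measurable ?N" if "v \<in> V" for v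
    using measurable_compose[OF measurable_coordinate[OF that] m\<phi>[OF that]] by measurable
  \<comment> \<open>Testing \<open>change\<close> with the constant 1 and factoring over the
    coordinates ties the normalising constants together.\<close>
  have Z: "Z = (\<Prod>v\<in>V. z v)"
  proof -
    have "Z = (\<integral>\<^sup>+x. (\<Prod>v\<in>V. ennreal (\<phi> v (x v))) \<partial>?N)"
      unfolding Z_def using change[of "\<lambda>_. 1"] by simp
    also have "\<dots> = (\<Prod>v\<in>V. z v)"
      unfolding z_def
      by (rule L.product_nn_integral_prod[OF fin]) (use m\<phi> in measurable)
    finally show ?thesis .
  qed
  show ?thesis
  proof (cases "\<forall>v\<in>V. z v \<noteq> 0 \<and> z v \<noteq> \<top>")
    case False
    then have "Z = 0 \<or> Z = \<top>" unfolding Z using ennreal_prod_degenerate[OF fin] by blast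
    then have "\<not> prob_space (law_prop ?N g)"
      using prob_space_law_prop_iff[OF mg] by (auto simp: Z_def)
    moreover obtain v where v: "v \<in> V" "z v = 0 \<or> z v = \<top>" using False by blast
    then have "\<not> prob_space (law_prop lborel (\<phi> v))"
      using prob_space_law_prop_iff[of "\<phi> v" lborel] m\<phi> by (auto simp: z_def)
    ultimately show ?thesis
      using M.prob_space_distr[OF K] M.prob_space_distr[OF rv[OF v(1)]] v(1) by metis
  next
    case True
    have prob: "prob_space (law_prop lborel (\<phi> v))" if "v \<in> V" for v
      using True that m\<phi> by (subst prob_space_law_prop_iff) (auto simp: z_def)
    define p where "p x = (\<Prod>v\<in>V. ennreal (\<phi> v (x v)) / z v)" for x :: "'v \<Rightarrow> real"
    have P: "?P = density ?N p"
      unfolding p_def z_def by (rule PiM_law_prop[OF fin m\<phi> prob])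
    have mp: "p \<in> borel_measurable ?N"
      unfolding p_def using mx by (intro borel_measurable_prod_ennreal borel_measurable_divide_ennreal) auto
    have sets_P: "sets ?P = sets ?B" unfolding P using sets_NB by simp
    have p_eq: "p x = (\<Prod>v\<in>V. ennreal (\<phi> v (x v))) / Z" for x
      unfolding p_def Z using True fin
      by (simp add: divide_ennreal_def prod.distrib ennreal_prod_inverse)
    have mT_P: "T \<in> measurable ?P ?B"
      using mT' by (simp cong: measurable_cong_sets add: sets_P)
    have law: "law_prop ?N g = distr ?P ?B T"
    proof (rule measure_eqI)
      show "sets (law_prop ?N g) = sets (distr ?P ?B T)" by (simp add: law_prop_def sets_NB)
      fix A assume "A \<in> sets (law_prop ?N g)"
      then have A: "A \<in> sets ?N" "A \<in> sets ?B" by (simp_all add: law_prop_def sets_NB)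
      have "emeasure (law_prop ?N g) A = (\<integral>\<^sup>+k. (indicator A k / Z) * ennreal (g k) \<partial>?N)"
        unfolding law_prop_def Z_def[symmetric] using mg A
        by (subst emeasure_density) (auto simp: divide_ennreal_def mult_ac)
      \<comment> \<open>The test function is the indicator of \<open>A\<close> with the normalising
        constant already divided in, so that the right-hand side is the normalised product density
        on the preimage of \<open>A\<close>.\<close>
      also have "\<dots> = (\<integral>\<^sup>+x. (indicator A (T x) / Z) * (\<Prod>v\<in>V. ennreal (\<phi> v (x v))) \<partial>?N)"
        by (rule change) (use A in measurable)
      also have "\<dots> = (\<integral>\<^sup>+x. p x * indicator (T -` A \<inter> space ?N) x \<partial>?N)"
        by (rule nn_integral_cong) (auto simp: p_eq divide_ennreal_def mult_ac indicator_def)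
      also have "\<dots> = emeasure ?P (T -` A \<inter> space ?P)"
        unfolding P using mp measurable_sets[OF mT A(1)] by (subst emeasure_density) auto
      also have "\<dots> = emeasure (distr ?P ?B T) A"
        using mT_P A by (simp add: emeasure_distr)
      finally show "emeasure (law_prop ?N g) A = emeasure (distr ?P ?B T) A" .
    qed
    have AE: "AE x in ?P. S (T x) = x"
    proof -
      have "S (T x) = x" if "x \<in> space ?N" "0 < p x" for x
        unfolding S_def
      proof (rule Y_T)
        show "x \<in> extensional V" using that(1) by (auto simp: space_PiM PiE_iff)
        fix v assume v: "v \<in> V"
        show "\<phi> v (x v) \<noteq> 0"
        proof
          assume "\<phi> v (x v) = 0"
          then have "p x = 0" unfolding p_def using v fin by (auto intro!: prod_zero bexI[of _ v])
          then show False using that by simp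
        qed
      qed
      then show ?thesis unfolding P using mp by (subst AE_density) auto
    qed
    have distr_S: "distr (distr ?P ?B T) ?B S = ?P"
    proof -
      have "distr (distr ?P ?B T) ?B S = distr ?P ?B (S \<circ> T)"
        by (rule distr_distr[OF mS mT_P])
      also have "\<dots> = distr ?P ?P (\<lambda>x. x)"
        using AE measurable_comp[OF mT_P mS] sets_P
        by (intro distr_cong_AE) (auto simp: measurable_ident_sets)
      also have "\<dots> = ?P" by simp
      finally show ?thesis .
    qed
    have indep: "M.indep_vars (\<lambda>_. borel) (\<lambda>v \<omega>. Y v (K \<omega>)) V \<longleftrightarrow>
        distr M ?B (\<lambda>\<omega>. S (K \<omega>)) = (\<Pi>\<^sub>M v\<in>V. distr M borel (\<lambda>\<omega>. Y v (K \<omega>)))"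
      using M.indep_vars_iff_distr_eq_PiM'[where M' = "\<lambda>_. borel" and X = "\<lambda>v \<omega>. Y v (K \<omega>)",
          OF ne] rv
      by (simp add: S_def)
    show ?thesis
    proof (intro iffI conjI ballI)
      assume K_law: "distr M ?B K = law_prop ?N g"
      have SK: "distr M ?B (\<lambda>\<omega>. S (K \<omega>)) = ?P"
      proof -
        have "distr M ?B (\<lambda>\<omega>. S (K \<omega>)) = distr (distr M ?B K) ?B S"
          by (simp add: distr_distr[OF mS K] comp_def)
        then show ?thesis unfolding K_law law distr_S .
      qed
      show marg: "distr M borel (\<lambda>\<omega>. Y v (K \<omega>)) = law_prop lborel (\<phi> v)" if v: "v \<in> V" for v
      proof -
        have "distr M borel (\<lambda>\<omega>. Y v (K \<omega>)) = distr (distr M ?B (\<lambda>\<omega>. S (K \<omega>))) borel (\<lambda>x. x v)"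
          using v mSK by (subst distr_distr) (auto simp: comp_def S_def)
        also have "\<dots> = distr ?P (law_prop lborel (\<phi> v)) (\<lambda>x. x v)"
          unfolding SK by (rule distr_cong) (auto simp: law_prop_def)
        also have "\<dots> = law_prop lborel (\<phi> v)"
          using prob v by (rule distr_PiM_component)
        finally show ?thesis .
      qed
      have "(\<Pi>\<^sub>M v\<in>V. distr M borel (\<lambda>\<omega>. Y v (K \<omega>))) = ?P"
        by (rule PiM_cong) (auto simp: marg)
      then show "M.indep_vars (\<lambda>_. borel) (\<lambda>v \<omega>. Y v (K \<omega>)) V"
        unfolding indep SK by simp
    next
      assume R: "M.indep_vars (\<lambda>_. borel) (\<lambda>v \<omega>. Y v (K \<omega>)) V \<and>
        (\<forall>v\<in>V. distr M borel (\<lambda>\<omega>. Y v (K \<omega>)) = law_prop lborel (\<phi> v))"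
      have "(\<Pi>\<^sub>M v\<in>V. distr M borel (\<lambda>\<omega>. Y v (K \<omega>))) = ?P"
        by (rule PiM_cong) (use R in auto)
      then have SK: "distr M ?B (\<lambda>\<omega>. S (K \<omega>)) = ?P" using R indep by simp
      \<comment> \<open>Because \<open>T\<close> undoes \<open>S\<close> at every outcome, the law
        of \<open>K\<close> is determined by that of \<open>S (K \<omega>)\<close>.\<close>
      have "distr M ?B K = distr M ?B (\<lambda>\<omega>. T (S (K \<omega>)))"
        by (rule distr_cong) (auto simp: S_def T_Y)
      also have "\<dots> = distr (distr M ?B (\<lambda>\<omega>. S (K \<omega>))) ?B T"
        by (simp add: distr_distr[OF mT' mSK] comp_def)
      also have "\<dots> = law_prop ?N g" unfolding SK law ..
      finally show "distr M ?B K = law_prop ?N g" .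
    qed
  qed
qed

section \<open>The laws on a rooted tree\<close>

context tree_beta
begin

text \<open>The exponent inherited from the parent; the value 0 at the root reduces the generalised
  beta density there to a beta density.\<close>

definition parexp :: "('v \<Rightarrow> real) \<Rightarrow> 'v \<Rightarrow> real" where
  "parexp a v = (if v = r then 0 else a (par v))"

text \<open>The exponent \<open>c\<close> is \<open>\<beta> - 1\<close> for the first kind and
  \<open>- \<beta>\<close> for the second.\<close>

definition joint :: "real \<Rightarrow> ('v \<Rightarrow> real) \<Rightarrow> ('v \<Rightarrow> real) \<Rightarrow> real" where
  "joint c a k = F V k powr c * (\<Prod>v\<in>V. k v powr (a v - 1)) * indicator D k"

definition marginal :: "real \<Rightarrow> ('v \<Rightarrow> real) \<Rightarrow> 'v \<Rightarrow> real \<Rightarrow> real" where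
  "marginal c a v x = x powr (a v - 1) * (1 + s * x) powr (c + parexp a v)
     * (1 + s * qp v * x) powr (- parexp a v) * indicator I x"

lemma I_borel [measurable]: "I \<in> sets borel"
  unfolding I_def by measurable

lemma h_measurable: "h w \<in> borel_measurable borel"
  unfolding h_def by measurable

lemma coordinate_borel: "v \<in> V \<Longrightarrow> (\<lambda>k. k v) \<in> borel_measurable (\<Pi>\<^sub>M v\<in>V. borel :: real measure)"
  by (rule measurable_component_singleton)

lemma F_measurable: assumes U: "U \<subseteq> V" shows "F U \<in> borel_measurable (\<Pi>\<^sub>M v\<in>V. borel)"
proof -
  have "(\<lambda>k. prod q (edges_in E W) * (\<Prod>v\<in>W. s * k v)) \<in> borel_measurable (\<Pi>\<^sub>M v\<in>V. borel)"
    if "W \<in> Pow U" for W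
    using that U coordinate_borel
    by (intro borel_measurable_times borel_measurable_const borel_measurable_prod) auto
  then show ?thesis unfolding F_def delta_def by (rule borel_measurable_sum)
qed

lemma Y_measurable: "v \<in> V \<Longrightarrow> Y v \<in> borel_measurable (\<Pi>\<^sub>M v\<in>V. borel)"
  unfolding Y_def using F_measurable cl_subset de_subset
  by (intro borel_measurable_times borel_measurable_diff borel_measurable_divide
      borel_measurable_const) auto

lemma sets_PiM_borel: "sets (\<Pi>\<^sub>M v\<in>V. lborel :: real measure) = sets (\<Pi>\<^sub>M v\<in>V. borel)"
  by (rule sets_PiM_cong) auto

lemma D_measurable: "D \<in> sets (\<Pi>\<^sub>M v\<in>V. borel)"
proof -
  have "{k \<in> space (\<Pi>\<^sub>M v\<in>V. borel). \<forall>U\<in>Pow V. 0 < F U k} \<in> sets (\<Pi>\<^sub>M v\<in>V. borel)"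
    using F_measurable
    by (intro sets.sets_Collect_finite_All' borel_measurable_less borel_measurable_const) auto
  moreover have "(\<Pi>\<^sub>E v\<in>V. {0<..}) \<in> sets (\<Pi>\<^sub>M v\<in>V. borel :: real measure)"
    by (rule sets_PiM_I_finite) auto
  moreover have "D = {k \<in> space (\<Pi>\<^sub>M v\<in>V. borel). \<forall>U\<in>Pow V. 0 < F U k} \<inter> (\<Pi>\<^sub>E v\<in>V. {0<..})"
    by (auto simp: D_def space_PiM)
  ultimately show ?thesis by simp
qed

lemma joint_measurable: "joint c a \<in> borel_measurable (\<Pi>\<^sub>M v\<in>V. lborel)"
proof -
  have "joint c a \<in> borel_measurable (\<Pi>\<^sub>M v\<in>V. borel)"
    unfolding joint_def using F_measurable[of V] D_measurable coordinate_borel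
    by (intro borel_measurable_times powr_real_measurable borel_measurable_prod
        borel_measurable_const borel_measurable_indicator) auto
  then show ?thesis by (simp cong: measurable_cong_sets add: sets_PiM_borel)
qed

lemma marginal_measurable: "marginal c a v \<in> borel_measurable borel"
  unfolding marginal_def by measurable

text \<open>For \<open>x\<close> with coordinates in \<open>I\<close> this is the cancellation
  between Jacobian and powers. For other \<open>x\<close> both sides vanish: by
  \<open>T_in_D_iff\<close>, the indicator of \<open>D\<close> at \<open>T x\<close> matches the
  product of the indicators of \<open>I\<close>.\<close>

lemma joint_T:
  assumes x: "x \<in> extensional V"
  shows "(\<Prod>v\<in>V. \<Prod>w\<in>ch v. h w (x w)) * joint c a (T x) = (\<Prod>v\<in>V. marginal c a v (x v))"
proof (cases "x \<in> V \<rightarrow>\<^sub>E I")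
  case True
  define C where "C v = (\<Prod>w\<in>ch v. h w (x w))" for v
  have xI: "x v \<in> I" "0 < x v" "0 < 1 + s * x v" if "v \<in> V" for v
    using True that by (auto simp: PiE_iff I_def)
  have C_pos: "0 < C v" for v
    unfolding C_def using child_in_V h_pos by (intro prod_pos) auto
  \<comment> \<open>The Jacobian factor raises the exponent of \<open>C v\<close> from
    \<open>a v - 1\<close> to \<open>a v\<close>.\<close>
  have C_powr: "C v * T x v powr (a v - 1) = x v powr (a v - 1) * C v powr a v" if v: "v \<in> V" for v
  proof -
    have "T x v = x v * C v" using v by (simp add: T_def C_def)
    moreover have "C v * C v powr (a v - 1) = C v powr a v"
      using C_pos[of v] by (simp add: powr_diff)
    ultimately show ?thesis
      using xI(2)[OF v] C_pos[of v] by (simp add: powr_mult mult_ac)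
  qed
  have "(\<Prod>v\<in>V. C v powr a v) = (\<Prod>v\<in>V. \<Prod>w\<in>ch v. h w (x w) powr a v)"
    unfolding C_def prod_powr_distrib ..
  also have "\<dots> = (\<Prod>w\<in>V - {r}. h w (x w) powr a (par w))" by (rule prod_ch)
  also have "\<dots> = (\<Prod>w\<in>V - {r}. h w (x w) powr parexp a w)"
    by (rule prod.cong) (auto simp: parexp_def)
  \<comment> \<open>The root joins with exponent 0. Positivity of \<open>h r\<close> matters here,
    since \<open>0 powr 0 = 0\<close>.\<close>
  also have "\<dots> = (\<Prod>w\<in>V. h w (x w) powr parexp a w)"
    using root h_pos[OF root, of "x r"] by (simp add: prod.remove[of V r] parexp_def)
  finally have C_prod: "(\<Prod>v\<in>V. C v powr a v) = (\<Prod>w\<in>V. h w (x w) powr parexp a w)" .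
  have "(\<Prod>v\<in>V. C v) * joint c a (T x) =
      (\<Prod>v\<in>V. 1 + s * x v) powr c * (\<Prod>v\<in>V. C v * T x v powr (a v - 1))"
    using T_in_D[OF True] by (simp add: joint_def F_V_T[OF True] prod.distrib)
  also have "\<dots> = (\<Prod>v\<in>V. (1 + s * x v) powr c * x v powr (a v - 1) * C v powr a v)"
    unfolding prod_powr_distrib prod.distrib[symmetric]
    by (rule prod.cong) (auto simp: C_powr mult_ac)
  also have "\<dots> = (\<Prod>v\<in>V. (1 + s * x v) powr c * x v powr (a v - 1) * h v (x v) powr parexp a v)"
    unfolding prod.distrib C_prod ..
  also have "\<dots> = (\<Prod>v\<in>V. marginal c a v (x v))"
  proof (rule prod.cong[OF refl])
    fix v assume v: "v \<in> V"
    have d: "0 < 1 + s * qp v * x v" using denom_pos[OF xI(1)[OF v] v] .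
    have "h v (x v) powr parexp a v =
        (1 + s * x v) powr parexp a v * (1 + s * qp v * x v) powr (- parexp a v)"
      using xI[OF v] d by (simp add: h_def powr_divide powr_minus_divide)
    then show "(1 + s * x v) powr c * x v powr (a v - 1) * h v (x v) powr parexp a v =
        marginal c a v (x v)"
      using xI(1)[OF v] by (simp add: marginal_def powr_add mult_ac)
  qed
  finally show ?thesis unfolding C_def .
next
  case False
  then obtain v where v: "v \<in> V" "x v \<notin> I" using x by (auto simp: PiE_iff)
  have "(\<Prod>v\<in>V. marginal c a v (x v)) = 0"
    using v by (intro prod_zero) (auto simp: marginal_def intro!: bexI[of _ v])
  moreover have "joint c a (T x) = 0" using False T_in_D_iff[OF x] by (simp add: joint_def)
  ultimately show ?thesis by simp
qed

lemma change_of_variables: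
  assumes f: "f \<in> borel_measurable (\<Pi>\<^sub>M v\<in>V. lborel)"
  shows "(\<integral>\<^sup>+k. f k * ennreal (joint c a k) \<partial>(\<Pi>\<^sub>M v\<in>V. lborel)) =
    (\<integral>\<^sup>+x. f (T x) * (\<Prod>v\<in>V. ennreal (marginal c a v (x v))) \<partial>(\<Pi>\<^sub>M v\<in>V. lborel))"
proof -
  have "(\<integral>\<^sup>+k. f k * ennreal (joint c a k) \<partial>(\<Pi>\<^sub>M v\<in>V. lborel)) =
      (\<integral>\<^sup>+x. ennreal (\<Prod>v\<in>V. \<Prod>w\<in>ch v. h w (x w)) * (f (T x) * ennreal (joint c a (T x)))
        \<partial>(\<Pi>\<^sub>M v\<in>V. lborel))"
    unfolding T_def
  proof (rule nn_integral_triangular_scaling[OF finite_V, where rk = rk])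
    show "ch v \<subseteq> {w \<in> V. rk v < rk w}" for v using ch_subset rk_less by blast
    show "(\<lambda>k. f k * ennreal (joint c a k)) \<in> borel_measurable (\<Pi>\<^sub>M v\<in>V. lborel)"
      using f joint_measurable by (intro borel_measurable_times_ennreal) auto
  qed (use h_measurable h_pos in auto)
  also have "\<dots> = (\<integral>\<^sup>+x. f (T x) * (\<Prod>v\<in>V. ennreal (marginal c a v (x v))) \<partial>(\<Pi>\<^sub>M v\<in>V. lborel))"
  proof (rule nn_integral_cong)
    fix x assume "x \<in> space (\<Pi>\<^sub>M v\<in>V. lborel :: real measure)"
    then have x: "x \<in> extensional V" by (auto simp: space_PiM PiE_iff)
    have "0 \<le> (\<Prod>v\<in>V. \<Prod>w\<in>ch v. h w (x w))"
      using h_pos child_in_V by (intro prod_nonneg) (auto intro: less_imp_le)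
    then have "ennreal (\<Prod>v\<in>V. \<Prod>w\<in>ch v. h w (x w)) * ennreal (joint c a (T x)) =
        ennreal (\<Prod>v\<in>V. marginal c a v (x v))"
      unfolding joint_T[OF x, symmetric] by (simp add: ennreal_mult')
    also have "\<dots> = (\<Prod>v\<in>V. ennreal (marginal c a v (x v)))"
      by (rule prod_ennreal[symmetric]) (simp add: marginal_def)
    finally show "ennreal (\<Prod>v\<in>V. \<Prod>w\<in>ch v. h w (x w)) * (f (T x) * ennreal (joint c a (T x))) =
        f (T x) * (\<Prod>v\<in>V. ennreal (marginal c a v (x v)))"
      by (subst mult.left_commute) (simp only:)
  qed
  finally show ?thesis .
qed

lemma joint_law_iff:
  assumes "prob_space M" "K \<in> measurable M (\<Pi>\<^sub>M v\<in>V. borel)"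
    and KD: "\<And>\<omega>. \<omega> \<in> space M \<Longrightarrow> K \<omega> \<in> D"
  shows "distr M (\<Pi>\<^sub>M v\<in>V. borel) K = law_prop (\<Pi>\<^sub>M v\<in>V. lborel) (joint c a) \<longleftrightarrow>
    prob_space.indep_vars M (\<lambda>_. borel) (\<lambda>v \<omega>. Y v (K \<omega>)) V \<and>
    (\<forall>v\<in>V. distr M borel (\<lambda>\<omega>. Y v (K \<omega>)) = law_prop lborel (marginal c a v))"
proof (rule law_transport[OF assms(1,2) finite_V, where T = T])
  show "V \<noteq> {}" using root by auto
  show "T \<in> measurable (\<Pi>\<^sub>M v\<in>V. lborel) (\<Pi>\<^sub>M v\<in>V. lborel)"
    unfolding T_def using ch_subset h_measurable by (intro measurable_triangular(2)) auto
  show "(\<lambda>v\<in>V. Y v (T x)) = x"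
    if "x \<in> extensional V" "\<And>v. v \<in> V \<Longrightarrow> marginal c a v (x v) \<noteq> 0" for x
  proof (rule Y_T)
    have "x v \<in> I" if "v \<in> V" for v
      using \<open>\<And>v. v \<in> V \<Longrightarrow> marginal c a v (x v) \<noteq> 0\<close>[OF that]
      by (auto simp: marginal_def indicator_def split: if_splits)
    then show "x \<in> V \<rightarrow>\<^sub>E I" using that(1) by (auto simp: PiE_iff)
  qed
qed (use marginal_measurable joint_measurable Y_measurable change_of_variables T_Y KD in auto)

lemma marginal_root: "marginal c a r = (\<lambda>x. x powr (a r - 1) * (1 + s * x) powr c * indicator I x)"
proof
  fix x
  show "marginal c a r x = x powr (a r - 1) * (1 + s * x) powr c * indicator I x"
    by (simp add: marginal_def parexp_def qp_def)
qed

lemma marginal_nonroot: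
  "v \<noteq> r \<Longrightarrow> marginal c a v = (\<lambda>x. x powr (a v - 1) * (1 + s * x) powr (c + a (par v))
     * (1 + s * q {par v, v} * x) powr (- a (par v)) * indicator I x)"
  by (simp add: marginal_def parexp_def qp_def fun_eq_iff)

lemma joint_law_iff_root:
  assumes "prob_space M" "K \<in> measurable M (\<Pi>\<^sub>M v\<in>V. borel)"
    and "\<And>\<omega>. \<omega> \<in> space M \<Longrightarrow> K \<omega> \<in> D"
  shows "distr M (\<Pi>\<^sub>M v\<in>V. borel) K = law_prop (\<Pi>\<^sub>M v\<in>V. lborel) (joint c a) \<longleftrightarrow>
    prob_space.indep_vars M (\<lambda>_. borel) (\<lambda>v \<omega>. Y v (K \<omega>)) V \<and>
    distr M borel (\<lambda>\<omega>. Y r (K \<omega>)) = law_prop lborel (marginal c a r) \<and>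
    (\<forall>v\<in>V - {r}. distr M borel (\<lambda>\<omega>. Y v (K \<omega>)) = law_prop lborel (marginal c a v))"
proof -
  have "(\<forall>v\<in>V. Q v) \<longleftrightarrow> Q r \<and> (\<forall>v\<in>V - {r}. Q v)" for Q using root by auto
  from joint_law_iff[OF assms, of c a, unfolded this] show ?thesis .
qed

end

section \<open>Specialisation to the two kinds of law\<close>

locale tree_beta_I = rooted_tree V E r for V :: "'v set" and E r +
  fixes q :: "'v set \<Rightarrow> real"
  assumes q_less: "e \<in> E \<Longrightarrow> q e < 1"

sublocale tree_beta_I \<subseteq> tree_beta V E r q "- 1"
  by unfold_locales (use q_less in auto)

context tree_beta_I
begin

lemma F_eq: "F U k = Delta E q U k"
  by (simp add: F_def Delta_eq_delta)

lemma Y_eq: "Y v k = Psi V E q r v k"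
  by (simp add: Y_def Psi_def F_eq)

lemma I_eq: "I = {0<..<1}"
  by (auto simp: I_def)

text \<open>\<open>D\<close> bounds the coordinates only from below; \<open>k v < 1\<close> is the
  positivity condition for \<open>U = {v}\<close>.\<close>

lemma D_eq: "D = TB_domain V E q"
proof -
  have "k v < 1" if k: "\<forall>U\<subseteq>V. 0 < Delta E q U k" and v: "v \<in> V" for k v
  proof -
    have "Delta E q {v} k = 1 - k v"
      unfolding Delta_eq_delta
      using delta_insert[OF edge_card, where A = "{}"] delta_empty[OF edge_card] by simp
    then show ?thesis using k v by (metis diff_gt_0_iff_gt empty_subsetI insert_subset)
  qed
  then show ?thesis by (auto simp: D_def TB_domain_def F_eq PiE_iff)
qed

lemma joint_eq: "law_prop (\<Pi>\<^sub>M v\<in>V. lborel) (joint (\<beta> - 1) a) = TB_I V E a \<beta> q"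
  unfolding joint_def TB_I_def F_eq D_eq ..

lemma marginal_root_eq: "law_prop lborel (marginal (\<beta> - 1) a r) = Beta_I (a r) \<beta>"
  unfolding marginal_root Beta_I_def I_eq by simp

lemma marginal_nonroot_eq:
  "v \<noteq> r \<Longrightarrow> law_prop lborel (marginal (\<beta> - 1) a v) =
     GB_I (a v) (\<beta> + a (parent V E r v)) (a (parent V E r v)) (q {parent V E r v, v})"
  unfolding marginal_nonroot GB_I_def I_eq par_def by (simp add: algebra_simps)

end

locale tree_beta_II = rooted_tree V E r for V :: "'v set" and E r +
  fixes q :: "'v set \<Rightarrow> real"
  assumes q_nonneg: "e \<in> E \<Longrightarrow> 0 \<le> q e"

sublocale tree_beta_II \<subseteq> tree_beta V E r q 1
  by unfold_locales (use q_nonneg in auto)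

context tree_beta_II
begin

lemma F_eq: "F U k = delta E q U k"
  by (simp add: F_def)

lemma Y_eq: "Y v k = psi V E q r v k"
  by (simp add: Y_def psi_def F_eq)

lemma I_eq: "I = {0<..}"
  by (auto simp: I_def)

text \<open>With nonnegative weights, positive coordinates already make every \<open>F U\<close>
  positive.\<close>

lemma D_eq: "D = V \<rightarrow>\<^sub>E {0<..}"
proof -
  have "0 < F U k" if "k \<in> V \<rightarrow>\<^sub>E {0<..}" "U \<subseteq> V" for U k
    using that(1) by (intro F_pos_of_pos[OF refl that(2)]) (auto simp: PiE_iff)
  then show ?thesis by (auto simp: D_def)
qed

lemma joint_eq: "law_prop (\<Pi>\<^sub>M v\<in>V. lborel) (joint (- \<beta>) a) = TB_II V E a \<beta> q"
  unfolding joint_def TB_II_def F_eq D_eq ..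

lemma marginal_root_eq: "law_prop lborel (marginal (- \<beta>) a r) = Beta_II (a r) \<beta>"
  unfolding marginal_root Beta_II_def I_eq by simp

text \<open>For weight 0 the last factor of the density is a power of 1, so the separate clause of
  \<open>GB_II\<close> gives the same law.\<close>

lemma marginal_nonroot_eq:
  assumes "v \<noteq> r"
  shows "law_prop lborel (marginal (- \<beta>) a v) =
     GB_II (a v) (\<beta> - a (parent V E r v)) (a (parent V E r v)) (q {parent V E r v, v})"
  using marginal_nonroot[OF assms]
  by (simp add: GB_II_def Beta_II_def I_eq par_def algebra_simps)

end

theorem theorem1p6:
  fixes V :: "'v set" and E :: "'v set set" and q :: "'v set \<Rightarrow> real"
    and a :: "'v \<Rightarrow> real" and \<beta> :: real
    and M :: "'w measure" and K :: "'w \<Rightarrow> 'v \<Rightarrow> real"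
  assumes "tree V E" and "1 < card V"
    and "prob_space M" and "K \<in> measurable M (\<Pi>\<^sub>M v\<in>V. borel)"
  shows
    "((\<forall>e\<in>E. q e < 1) \<and> 0 < \<beta> \<and> (\<forall>v\<in>V. 0 < a v) \<and>
        (\<forall>\<omega>\<in>space M. K \<omega> \<in> TB_domain V E q) \<longrightarrow>
        (distr M (\<Pi>\<^sub>M v\<in>V. borel) K = TB_I V E a \<beta> q \<longleftrightarrow>
          (\<forall>r\<in>V.
             prob_space.indep_vars M (\<lambda>_. borel) (\<lambda>v \<omega>. Psi V E q r v (K \<omega>)) V \<and>
             distr M borel (\<lambda>\<omega>. Psi V E q r r (K \<omega>)) = Beta_I (a r) \<beta> \<and>
             (\<forall>v\<in>V - {r}.
                distr M borel (\<lambda>\<omega>. Psi V E q r v (K \<omega>)) =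
                  GB_I (a v) (\<beta> + a (parent V E r v)) (a (parent V E r v))
                    (q {parent V E r v, v})))))
     \<and>
     ((\<forall>e\<in>E. 0 \<le> q e) \<and> 0 < \<beta> \<and> (\<forall>v\<in>V. 0 < a v \<and> a v < \<beta>) \<and>
        (\<forall>v w. {v, w} \<in> E \<and> q {v, w} = 0 \<longrightarrow> a v + a w < \<beta>) \<and>
        (\<forall>\<omega>\<in>space M. K \<omega> \<in> V \<rightarrow>\<^sub>E {0<..}) \<longrightarrow>
        (distr M (\<Pi>\<^sub>M v\<in>V. borel) K = TB_II V E a \<beta> q \<longleftrightarrow>
          (\<forall>r\<in>V.
             prob_space.indep_vars M (\<lambda>_. borel) (\<lambda>v \<omega>. psi V E q r v (K \<omega>)) V \<and>
             distr M borel (\<lambda>\<omega>. psi V E q r r (K \<omega>)) = Beta_II (a r) \<beta> \<and>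
             (\<forall>v\<in>V - {r}.
                distr M borel (\<lambda>\<omega>. psi V E q r v (K \<omega>)) =
                  GB_II (a v) (\<beta> - a (parent V E r v)) (a (parent V E r v))
                    (q {parent V E r v, v})))))"
    (is "(?hyp1 \<longrightarrow> (?K1 \<longleftrightarrow> (\<forall>r\<in>V. ?R1 r))) \<and> (?hyp2 \<longrightarrow> (?K2 \<longleftrightarrow> (\<forall>r\<in>V. ?R2 r)))")
proof (intro conjI impI)
  have ne: "V \<noteq> {}" using assms(1) by (simp add: tree_def)
  {
    assume hyp: ?hyp1
    have "?K1 \<longleftrightarrow> ?R1 r" if r: "r \<in> V" for r
    proof -
      interpret tree_beta_I V E r q
        by unfold_locales (use assms(1) r hyp in auto)
      have "\<And>\<omega>. \<omega> \<in> space M \<Longrightarrow> K \<omega> \<in> D" using hyp by (simp add: D_eq)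
      from joint_law_iff_root[OF assms(3,4) this, of "\<beta> - 1" a] show ?thesis
        by (simp add: joint_eq Y_eq marginal_root_eq marginal_nonroot_eq)
    qed
    \<comment> \<open>The left-hand side does not mention the root, so equivalence at each single
      root gives the quantified one, as \<open>V\<close> is nonempty.\<close>
    then show "?K1 \<longleftrightarrow> (\<forall>r\<in>V. ?R1 r)" using ne by blast
  }
  {
    assume hyp: ?hyp2
    have "?K2 \<longleftrightarrow> ?R2 r" if r: "r \<in> V" for r
    proof -
      interpret tree_beta_II V E r q
        by unfold_locales (use assms(1) r hyp in auto)
      have "\<And>\<omega>. \<omega> \<in> space M \<Longrightarrow> K \<omega> \<in> D" using hyp by (simp add: D_eq)
      from joint_law_iff_root[OF assms(3,4) this, of "- \<beta>" a] show ?thesis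
        by (simp add: joint_eq Y_eq marginal_root_eq marginal_nonroot_eq)
    qed
    then show "?K2 \<longleftrightarrow> (\<forall>r\<in>V. ?R2 r)" using ne by blast
  }
qed

end
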